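(* Let $n\geq 1$, let $(\mathcal{C},\Sigma,\mathcal{T})$ be a weak pre-$(n+2)$-angulated category (respectively, a weak $(n+2)$-angulated category) and suppose $\mathscr{F}\colon\mathcal{C}\to\mathcal{C}'$ is an equivalence of categories. Then $\mathcal{C}'$ is a weak pre-$(n+2)$-angulated category (respectively, a weak $(n+2)$-angulated category) and $\mathscr{F}$ is an $(n+2)$-angle equivalence; that is, there exist an autoequivalence $\Sigma'$ of $\mathcal{C}'$ and a class $\mathcal{T}'$ of $(n+2)$-$\Sigma'$-sequences in $\mathcal{C}'$ such that $(\mathcal{C}',\Sigma',\mathcal{T}')$ is a weak pre-$(n+2)$-angulated category (respectively, a weak $(n+2)$-angulated category) and $\mathscr{F}\colon(\mathcal{C},\Sigma,\mathcal{T})\to(\mathcal{C}',\Sigma',\mathcal{T}')$ is an $(n+2)$-angle equivalence.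
   Context: Fix an integer $n\geq 1$, an additive category $\mathcal{C}$ and an autoequivalence $\Sigma\colon\mathcal{C}\to\mathcal{C}$ (not necessarily an automorphism). An $(n+2)$-$\Sigma$-sequence is a sequence of morphisms $X^0\xrightarrow{d_X^0}X^1\xrightarrow{d_X^1}\cdots\xrightarrow{d_X^n}X^{n+1}\xrightarrow{d_X^{n+1}}\Sigma X^0$ in $\mathcal{C}$. A morphism of $(n+2)$-$\Sigma$-sequences from $(X^i,d_X^i)$ to $(Y^i,d_Y^i)$ is a tuple $(f^0,\dots,f^{n+1})$ of morphisms $f^i\colon X^i\to Y^i$ with $f^{i+1}d_X^i=d_Y^if^i$ for $0\leq i\leq n$ and $(\Sigma f^0)d_X^{n+1}=d_Y^{n+1}f^{n+1}$. Let $\mathcal{T}$ be a class of $(n+2)$-$\Sigma$-sequences. The triple $(\mathcal{C},\Sigma,\mathcal{T})$ is a weak pre-$(n+2)$-angulated category if (F1)–(F3) hold, and a weak $(n+2)$-angulated category if (F1)–(F4) hold: (F1) (a) $\mathcal{T}$ is closed under finite direct sums and direct summands; (b) for each $X\in\mathcal{C}$ the sequence $X\xrightarrow{1_X}X\to 0\to\cdots\to 0\to\Sigma X$ is in $\mathcal{T}$; (c) each morphism $d_X^0$ of $\mathcal{C}$ is the first morphism of some member of $\mathcal{T}$. (F2) $X^0\xrightarrow{d_X^0}\cdots\xrightarrow{d_X^n}X^{n+1}\xrightarrow{d_X^{n+1}}\Sigma X^0$ is in $\mathcal{T}$ if and only if $X^1\xrightarrow{d_X^1}\cdots\xrightarrow{d_X^n}X^{n+1}\xrightarrow{d_X^{n+1}}\Sigma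 X^0\xrightarrow{(-1)^n\Sigma d_X^0}\Sigma X^1$ is in $\mathcal{T}$. (F3) Given two members $(X^i,d_X^i)$, $(Y^i,d_Y^i)$ of $\mathcal{T}$ and morphisms $f^0\colon X^0\to Y^0$, $f^1\colon X^1\to Y^1$ with $f^1d_X^0=d_Y^0f^0$, there are $f^2,\dots,f^{n+1}$ such that $(f^0,\dots,f^{n+1})$ is a morphism of $(n+2)$-$\Sigma$-sequences. (F4) In (F3), $f^2,\dots,f^{n+1}$ can be chosen so that the cone $X^1\oplus Y^0\xrightarrow{d_C^0}X^2\oplus Y^1\xrightarrow{d_C^1}\cdots\xrightarrow{d_C^n}\Sigma X^0\oplus Y^{n+1}\xrightarrow{d_C^{n+1}}\Sigma X^1\oplus\Sigma Y^0$ lies in $\mathcal{T}$, where $d_C^i=\begin{pmatrix}-d_X^{i+1}&0\\ f^{i+1}&d_Y^i\end{pmatrix}$, $d_X^{n+2}:=\Sigma d_X^0$, $f^{n+2}:=\Sigma f^0$. Members of $\mathcal{T}$ are called $(n+2)$-angles. An additive covariant functor $\mathscr{F}\colon\mathcal{C}\to\mathcal{C}'$ between weak (pre-)$(n+2)$-angulated categories $(\mathcal{C},\Sigma,\mathcal{T})$ and $(\mathcal{C}',\Sigma',\mathcal{T}')$ is an $(n+2)$-angulated functor if there is a natural isomorphism $\Theta\colon\mathscr{F}\Sigma\Rightarrow\Sigma'\mathscr{F}$ such that for every $(n+2)$-angle $X^0\xrightarrow{d_X^0}\cdots\xrightarrow{d_X^n}X^{n+1}\xrightarrow{d_X^{n+1}}\Sigma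 X^0$ in $\mathcal{C}$, the sequence $\mathscr{F}X^0\xrightarrow{\mathscr{F}d_X^0}\cdots\xrightarrow{\mathscr{F}d_X^n}\mathscr{F}X^{n+1}\xrightarrow{\Theta_{X^0}\circ\mathscr{F}d_X^{n+1}}\Sigma'\mathscr{F}X^0$ is an $(n+2)$-angle in $\mathcal{C}'$. It is an $(n+2)$-angle equivalence if it is moreover an equivalence of categories. *)

theory Defs
  imports "HOL-Algebra.Group"
begin

record ('o, 'm) cat =
  Ob :: "'o set"
  Mor :: "'m set"
  Src :: "'m \<Rightarrow> 'o"
  Tgt :: "'m \<Rightarrow> 'o"
  Idn :: "'o \<Rightarrow> 'm"
  Cmp :: "'m \<Rightarrow> 'm \<Rightarrow> 'm"  (infixr "\<cdot>\<index>" 75)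

definition Hom :: "('o, 'm) cat \<Rightarrow> 'o \<Rightarrow> 'o \<Rightarrow> 'm set" where
  "Hom C X Y = {f \<in> Mor C. Src C f = X \<and> Tgt C f = Y}"

locale category =
  fixes C :: "('o, 'm) cat" (structure)
  assumes Src_Ob: "f \<in> Mor C \<Longrightarrow> Src C f \<in> Ob C"
    and Tgt_Ob: "f \<in> Mor C \<Longrightarrow> Tgt C f \<in> Ob C"
    and Idn_Hom: "X \<in> Ob C \<Longrightarrow> Idn C X \<in> Hom C X X"
    and Cmp_Hom: "\<lbrakk>f \<in> Hom C X Y; g \<in> Hom C Y Z\<rbrakk> \<Longrightarrow> g \<cdot> f \<in> Hom C X Z"
    and Cmp_Idn_left: "f \<in> Hom C X Y \<Longrightarrow> Idn C Y \<cdot> f = f"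
    and Cmp_Idn_right: "f \<in> Hom C X Y \<Longrightarrow> f \<cdot> Idn C X = f"
    and Cmp_assoc: "\<lbrakk>f \<in> Hom C W X; g \<in> Hom C X Y; h \<in> Hom C Y Z\<rbrakk>
                      \<Longrightarrow> (h \<cdot> g) \<cdot> f = h \<cdot> (g \<cdot> f)"

definition isomorphism_in :: "('o, 'm) cat \<Rightarrow> 'm \<Rightarrow> bool" where
  "isomorphism_in C f \<longleftrightarrow> f \<in> Mor C \<and>
     (\<exists>g \<in> Hom C (Tgt C f) (Src C f).
        g \<cdot>\<^bsub>C\<^esub> f = Idn C (Src C f) \<and> f \<cdot>\<^bsub>C\<^esub> g = Idn C (Tgt C f))"

definition zero_object :: "('o, 'm) cat \<Rightarrow> 'o \<Rightarrow> bool" where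
  "zero_object C Z \<longleftrightarrow> Z \<in> Ob C \<and>
     (\<forall>X \<in> Ob C. (\<exists>!f. f \<in> Hom C X Z) \<and> (\<exists>!f. f \<in> Hom C Z X))"


section \<open>Functors and equivalences\<close>

record ('o, 'm, 'p, 'q) cat_functor =
  Fob :: "'o \<Rightarrow> 'p"
  Fmor :: "'m \<Rightarrow> 'q"

definition is_functor :: "('o, 'm) cat \<Rightarrow> ('p, 'q) cat \<Rightarrow> ('o, 'm, 'p, 'q) cat_functor \<Rightarrow> bool" where
  "is_functor C D F \<longleftrightarrow>
     (\<forall>X \<in> Ob C. Fob F X \<in> Ob D) \<and>
     (\<forall>X Y. \<forall>f \<in> Hom C X Y. Fmor F f \<in> Hom D (Fob F X) (Fob F Y)) \<and>
     (\<forall>X \<in> Ob C. Fmor F (Idn C X) = Idn D (Fob F X)) \<and>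
     (\<forall>X Y Z. \<forall>f \<in> Hom C X Y. \<forall>g \<in> Hom C Y Z.
        Fmor F (g \<cdot>\<^bsub>C\<^esub> f) = Fmor F g \<cdot>\<^bsub>D\<^esub> Fmor F f)"

definition id_functor :: "('o, 'm, 'o, 'm) cat_functor" where
  "id_functor = \<lparr>Fob = (\<lambda>X. X), Fmor = (\<lambda>f. f)\<rparr>"

definition comp_functor ::
  "('p, 'q, 'r, 's) cat_functor \<Rightarrow> ('o, 'm, 'p, 'q) cat_functor \<Rightarrow> ('o, 'm, 'r, 's) cat_functor" where
  "comp_functor G F = \<lparr>Fob = Fob G \<circ> Fob F, Fmor = Fmor G \<circ> Fmor F\<rparr>"

definition natural_iso ::
  "('o, 'm) cat \<Rightarrow> ('p, 'q) cat \<Rightarrow> ('o, 'm, 'p, 'q) cat_functor \<Rightarrow> ('o, 'm, 'p, 'q) cat_functor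
     \<Rightarrow> ('o \<Rightarrow> 'q) \<Rightarrow> bool" where
  "natural_iso C D F G \<theta> \<longleftrightarrow>
     (\<forall>X \<in> Ob C. \<theta> X \<in> Hom D (Fob F X) (Fob G X) \<and> isomorphism_in D (\<theta> X)) \<and>
     (\<forall>X Y. \<forall>f \<in> Hom C X Y. \<theta> Y \<cdot>\<^bsub>D\<^esub> Fmor F f = Fmor G f \<cdot>\<^bsub>D\<^esub> \<theta> X)"

definition is_equivalence ::
  "('o, 'm) cat \<Rightarrow> ('p, 'q) cat \<Rightarrow> ('o, 'm, 'p, 'q) cat_functor \<Rightarrow> bool" where
  "is_equivalence C D F \<longleftrightarrow> is_functor C D F \<and>
     (\<exists>G \<eta> \<epsilon>. is_functor D C G \<and>
        natural_iso C C id_functor (comp_functor G F) \<eta> \<and>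
        natural_iso D D (comp_functor F G) id_functor \<epsilon>)"

abbreviation autoequivalence :: "('o, 'm) cat \<Rightarrow> ('o, 'm, 'o, 'm) cat_functor \<Rightarrow> bool" where
  "autoequivalence C S \<equiv> is_equivalence C C S"


section \<open>Additive categories\<close>

text \<open>The addition of morphisms is kept apart from the category, so that
  an equivalence of categories can be stated for a bare category as target.\<close>

record ('o, 'm) hom_addition =
  Add :: "'m \<Rightarrow> 'm \<Rightarrow> 'm"
  Zero :: "'o \<Rightarrow> 'o \<Rightarrow> 'm"

definition Hom_group :: "('o, 'm) cat \<Rightarrow> ('o, 'm) hom_addition \<Rightarrow> 'o \<Rightarrow> 'o \<Rightarrow> 'm monoid" where
  "Hom_group C A X Y = \<lparr>carrier = Hom C X Y, monoid.mult = Add A, one = Zero A X Y\<rparr>"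

definition Neg :: "('o, 'm) cat \<Rightarrow> ('o, 'm) hom_addition \<Rightarrow> 'm \<Rightarrow> 'm" where
  "Neg C A f = inv\<^bsub>Hom_group C A (Src C f) (Tgt C f)\<^esub> f"

record ('o, 'm) biproduct =
  Bob :: 'o
  In1 :: 'm
  In2 :: 'm
  Pr1 :: 'm
  Pr2 :: 'm

definition is_biproduct ::
  "('o, 'm) cat \<Rightarrow> ('o, 'm) hom_addition \<Rightarrow> 'o \<Rightarrow> 'o \<Rightarrow> ('o, 'm) biproduct \<Rightarrow> bool" where
  "is_biproduct C A X Y B \<longleftrightarrow>
     Bob B \<in> Ob C \<and>
     In1 B \<in> Hom C X (Bob B) \<and> In2 B \<in> Hom C Y (Bob B) \<and>
     Pr1 B \<in> Hom C (Bob B) X \<and> Pr2 B \<in> Hom C (Bob B) Y \<and>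
     Pr1 B \<cdot>\<^bsub>C\<^esub> In1 B = Idn C X \<and> Pr2 B \<cdot>\<^bsub>C\<^esub> In2 B = Idn C Y \<and>
     Pr1 B \<cdot>\<^bsub>C\<^esub> In2 B = Zero A Y X \<and> Pr2 B \<cdot>\<^bsub>C\<^esub> In1 B = Zero A X Y \<and>
     Add A (In1 B \<cdot>\<^bsub>C\<^esub> Pr1 B) (In2 B \<cdot>\<^bsub>C\<^esub> Pr2 B) = Idn C (Bob B)"

locale additive_category = category C
  for C :: "('o, 'm) cat" (structure) +
  fixes A :: "('o, 'm) hom_addition"
  assumes Hom_comm_group: "\<lbrakk>X \<in> Ob C; Y \<in> Ob C\<rbrakk> \<Longrightarrow> comm_group (Hom_group C A X Y)"
    and Cmp_Add_left: "\<lbrakk>f \<in> Hom C X Y; g \<in> Hom C Y Z; h \<in> Hom C Y Z\<rbrakk>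
                         \<Longrightarrow> Add A g h \<cdot> f = Add A (g \<cdot> f) (h \<cdot> f)"
    and Cmp_Add_right: "\<lbrakk>f \<in> Hom C X Y; g \<in> Hom C X Y; h \<in> Hom C Y Z\<rbrakk>
                         \<Longrightarrow> h \<cdot> Add A f g = Add A (h \<cdot> f) (h \<cdot> g)"
    and ex_zero_object: "\<exists>Z. zero_object C Z"
    and ex_biproduct: "\<lbrakk>X \<in> Ob C; Y \<in> Ob C\<rbrakk> \<Longrightarrow> \<exists>B. is_biproduct C A X Y B"

definition additive_functor ::
  "('o, 'm) cat \<Rightarrow> ('o, 'm) hom_addition \<Rightarrow> ('p, 'q) cat \<Rightarrow> ('p, 'q) hom_addition
     \<Rightarrow> ('o, 'm, 'p, 'q) cat_functor \<Rightarrow> bool" where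
  "additive_functor C A D A' F \<longleftrightarrow> is_functor C D F \<and>
     (\<forall>X Y. \<forall>f \<in> Hom C X Y. \<forall>g \<in> Hom C X Y.
        Fmor F (Add A f g) = Add A' (Fmor F f) (Fmor F g))"

text \<open>The entries are given by rows: the first row is \<open>a\<close>, \<open>b\<close> and the second row is \<open>c\<close>, \<open>d\<close>.\<close>

definition matrix_mor ::
  "('o, 'm) cat \<Rightarrow> ('o, 'm) hom_addition \<Rightarrow> ('o, 'm) biproduct \<Rightarrow> ('o, 'm) biproduct
     \<Rightarrow> 'm \<Rightarrow> 'm \<Rightarrow> 'm \<Rightarrow> 'm \<Rightarrow> 'm" where
  "matrix_mor C A B B' a b c d =
     Add A
       (Add A (In1 B' \<cdot>\<^bsub>C\<^esub> a \<cdot>\<^bsub>C\<^esub> Pr1 B) (In1 B' \<cdot>\<^bsub>C\<^esub> b \<cdot>\<^bsub>C\<^esub> Pr2 B))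
       (Add A (In2 B' \<cdot>\<^bsub>C\<^esub> c \<cdot>\<^bsub>C\<^esub> Pr1 B) (In2 B' \<cdot>\<^bsub>C\<^esub> d \<cdot>\<^bsub>C\<^esub> Pr2 B))"

definition map_biproduct ::
  "('o, 'm, 'p, 'q) cat_functor \<Rightarrow> ('o, 'm) biproduct \<Rightarrow> ('p, 'q) biproduct" where
  "map_biproduct F B = \<lparr>Bob = Fob F (Bob B), In1 = Fmor F (In1 B), In2 = Fmor F (In2 B),
                        Pr1 = Fmor F (Pr1 B), Pr2 = Fmor F (Pr2 B)\<rparr>"


section \<open>Sequences and their morphisms\<close>

text \<open>A sequence is the list of its n + 2 morphisms; the i-th object is the source of
  the i-th morphism. Morphisms of sequences are lists of their n + 2 components.\<close>

definition sigma_seq ::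
  "('o, 'm) cat \<Rightarrow> nat \<Rightarrow> ('o, 'm, 'o, 'm) cat_functor \<Rightarrow> 'm list \<Rightarrow> bool" where
  "sigma_seq C n S X \<longleftrightarrow> length X = n + 2 \<and> set X \<subseteq> Mor C \<and>
     (\<forall>i \<le> n. Tgt C (X ! i) = Src C (X ! (i + 1))) \<and>
     Tgt C (X ! (n + 1)) = Fob S (Src C (X ! 0))"

definition seq_mor ::
  "('o, 'm) cat \<Rightarrow> nat \<Rightarrow> ('o, 'm, 'o, 'm) cat_functor \<Rightarrow> 'm list \<Rightarrow> 'm list \<Rightarrow> 'm list \<Rightarrow> bool" where
  "seq_mor C n S X Y f \<longleftrightarrow> length f = n + 2 \<and>
     (\<forall>i \<le> n + 1. f ! i \<in> Hom C (Src C (X ! i)) (Src C (Y ! i))) \<and>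
     (\<forall>i \<le> n. f ! (i + 1) \<cdot>\<^bsub>C\<^esub> X ! i = Y ! i \<cdot>\<^bsub>C\<^esub> f ! i) \<and>
     Fmor S (f ! 0) \<cdot>\<^bsub>C\<^esub> X ! (n + 1) = Y ! (n + 1) \<cdot>\<^bsub>C\<^esub> f ! (n + 1)"

text \<open>\<open>W\<close> is a biproduct of \<open>X\<close> and \<open>Y\<close> in the category of sequences.\<close>

definition seq_direct_sum ::
  "('o, 'm) cat \<Rightarrow> ('o, 'm) hom_addition \<Rightarrow> nat \<Rightarrow> ('o, 'm, 'o, 'm) cat_functor
     \<Rightarrow> 'm list \<Rightarrow> 'm list \<Rightarrow> 'm list \<Rightarrow> bool" where
  "seq_direct_sum C A n S X Y W \<longleftrightarrow>
     sigma_seq C n S X \<and> sigma_seq C n S Y \<and> sigma_seq C n S W \<and>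
     (\<exists>i1 i2 p1 p2.
        seq_mor C n S X W i1 \<and> seq_mor C n S Y W i2 \<and>
        seq_mor C n S W X p1 \<and> seq_mor C n S W Y p2 \<and>
        (\<forall>k \<le> n + 1. is_biproduct C A (Src C (X ! k)) (Src C (Y ! k))
           \<lparr>Bob = Src C (W ! k), In1 = i1 ! k, In2 = i2 ! k, Pr1 = p1 ! k, Pr2 = p2 ! k\<rparr>))"

definition trivial_seq ::
  "('o, 'm) cat \<Rightarrow> ('o, 'm) hom_addition \<Rightarrow> nat \<Rightarrow> ('o, 'm, 'o, 'm) cat_functor
     \<Rightarrow> 'o \<Rightarrow> 'o \<Rightarrow> 'm list" where
  "trivial_seq C A n S X Z =
     [Idn C X, Zero A X Z] @ replicate (n - 1) (Zero A Z Z) @ [Zero A Z (Fob S X)]"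

definition rotation ::
  "('o, 'm) cat \<Rightarrow> ('o, 'm) hom_addition \<Rightarrow> nat \<Rightarrow> ('o, 'm, 'o, 'm) cat_functor
     \<Rightarrow> 'm list \<Rightarrow> 'm list" where
  "rotation C A n S X =
     tl X @ [if even n then Fmor S (X ! 0) else Neg C A (Fmor S (X ! 0))]"

text \<open>\<open>B i\<close>, for \<open>i \<le> n + 1\<close>, is a biproduct of the objects numbered i + 1 of \<open>X\<close>
  and i of \<open>Y\<close>. The direct sum in which the cone ends is taken to be the image under
  \<open>S\<close> of \<open>B 0\<close>, so that the cone is again a sequence.\<close>

definition cone_biproducts ::
  "('o, 'm) cat \<Rightarrow> ('o, 'm) hom_addition \<Rightarrow> nat \<Rightarrow> ('o, 'm, 'o, 'm) cat_functor
     \<Rightarrow> 'm list \<Rightarrow> 'm list \<Rightarrow> (nat \<Rightarrow> ('o, 'm) biproduct) \<Rightarrow> bool" where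
  "cone_biproducts C A n S X Y B \<longleftrightarrow>
     (\<forall>i \<le> n + 1. is_biproduct C A
        (Src C ((X @ [Fmor S (X ! 0)]) ! (i + 1))) (Src C (Y ! i)) (B i))"

definition cone ::
  "('o, 'm) cat \<Rightarrow> ('o, 'm) hom_addition \<Rightarrow> nat \<Rightarrow> ('o, 'm, 'o, 'm) cat_functor
     \<Rightarrow> 'm list \<Rightarrow> 'm list \<Rightarrow> 'm list \<Rightarrow> (nat \<Rightarrow> ('o, 'm) biproduct) \<Rightarrow> 'm list" where
  "cone C A n S X Y f B =
     (let dX = X @ [Fmor S (X ! 0)];
          f' = f @ [Fmor S (f ! 0)];
          B' = B(n + 2 := map_biproduct S (B 0))
      in map (\<lambda>i. matrix_mor C A (B' i) (B' (i + 1))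
                    (Neg C A (dX ! (i + 1))) (Zero A (Src C (Y ! i)) (Tgt C (dX ! (i + 1))))
                    (f' ! (i + 1))           (Y ! i))
             [0..<n + 2])"


section \<open>Weak (pre-)(n+2)-angulated categories\<close>

text \<open>Closure under finite direct sums is closure under the empty one (any sequence of
  zero objects) and under binary ones. Direct sums being determined only up to isomorphism,
  \<open>F1_sum\<close>, \<open>F1_summand\<close> and \<open>F4\<close> refer to every biproduct; in particular
  \<open>T\<close> is closed under isomorphism.\<close>

locale weak_pre_angulated_category = additive_category C A
  for C :: "('o, 'm) cat" (structure) and A :: "('o, 'm) hom_addition" +
  fixes n :: nat
    and S :: "('o, 'm, 'o, 'm) cat_functor"
    and T :: "'m list set"
  assumes autoequivalence_S: "autoequivalence C S"
    and T_sigma_seq: "X \<in> T \<Longrightarrow> sigma_seq C n S X"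
    and F1_zero: "\<lbrakk>sigma_seq C n S X; \<And>i. i \<le> n + 1 \<Longrightarrow> zero_object C (Src C (X ! i))\<rbrakk>
                    \<Longrightarrow> X \<in> T"
    and F1_sum: "\<lbrakk>seq_direct_sum C A n S X Y W; X \<in> T; Y \<in> T\<rbrakk> \<Longrightarrow> W \<in> T"
    and F1_summand: "\<lbrakk>seq_direct_sum C A n S X Y W; W \<in> T\<rbrakk> \<Longrightarrow> X \<in> T \<and> Y \<in> T"
    and F1_trivial: "\<lbrakk>x \<in> Ob C; zero_object C z\<rbrakk> \<Longrightarrow> trivial_seq C A n S x z \<in> T"
    and F1_first: "f \<in> Mor C \<Longrightarrow> \<exists>X \<in> T. X ! 0 = f"
    and F2: "sigma_seq C n S X \<Longrightarrow> X \<in> T \<longleftrightarrow> rotation C A n S X \<in> T"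
    and F3: "\<lbrakk>X \<in> T; Y \<in> T;
              f0 \<in> Hom C (Src C (X ! 0)) (Src C (Y ! 0));
              f1 \<in> Hom C (Src C (X ! 1)) (Src C (Y ! 1));
              f1 \<cdot> X ! 0 = Y ! 0 \<cdot> f0\<rbrakk>
             \<Longrightarrow> \<exists>f. seq_mor C n S X Y f \<and> f ! 0 = f0 \<and> f ! 1 = f1"

locale weak_angulated_category = weak_pre_angulated_category C A n S T
  for C :: "('o, 'm) cat" (structure) and A :: "('o, 'm) hom_addition"
    and n :: nat and S :: "('o, 'm, 'o, 'm) cat_functor" and T :: "'m list set" +
  assumes F4: "\<lbrakk>X \<in> T; Y \<in> T;
              f0 \<in> Hom C (Src C (X ! 0)) (Src C (Y ! 0));
              f1 \<in> Hom C (Src C (X ! 1)) (Src C (Y ! 1));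
              f1 \<cdot> X ! 0 = Y ! 0 \<cdot> f0\<rbrakk>
             \<Longrightarrow> \<exists>f. seq_mor C n S X Y f \<and> f ! 0 = f0 \<and> f ! 1 = f1 \<and>
                   (\<forall>B. cone_biproducts C A n S X Y B \<longrightarrow> cone C A n S X Y f B \<in> T)"

definition angulated_functor ::
  "nat \<Rightarrow> ('o, 'm) cat \<Rightarrow> ('o, 'm) hom_addition \<Rightarrow> ('o, 'm, 'o, 'm) cat_functor \<Rightarrow> 'm list set
     \<Rightarrow> ('p, 'q) cat \<Rightarrow> ('p, 'q) hom_addition \<Rightarrow> ('p, 'q, 'p, 'q) cat_functor \<Rightarrow> 'q list set
     \<Rightarrow> ('o, 'm, 'p, 'q) cat_functor \<Rightarrow> bool" where
  "angulated_functor n C A S T C' A' S' T' F \<longleftrightarrow>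
     additive_functor C A C' A' F \<and>
     (\<exists>\<Theta>. natural_iso C C' (comp_functor F S) (comp_functor S' F) \<Theta> \<and>
        (\<forall>X \<in> T. map (Fmor F) (butlast X) @ [\<Theta> (Src C (X ! 0)) \<cdot>\<^bsub>C'\<^esub> Fmor F (last X)] \<in> T'))"

definition angle_equivalence ::
  "nat \<Rightarrow> ('o, 'm) cat \<Rightarrow> ('o, 'm) hom_addition \<Rightarrow> ('o, 'm, 'o, 'm) cat_functor \<Rightarrow> 'm list set
     \<Rightarrow> ('p, 'q) cat \<Rightarrow> ('p, 'q) hom_addition \<Rightarrow> ('p, 'q, 'p, 'q) cat_functor \<Rightarrow> 'q list set
     \<Rightarrow> ('o, 'm, 'p, 'q) cat_functor \<Rightarrow> bool" where
  "angle_equivalence n C A S T C' A' S' T' F \<longleftrightarrow>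
     angulated_functor n C A S T C' A' S' T' F \<and> is_equivalence C C' F"

end

theory Submission imports Defs
begin

text \<open>Let \<open>G\<close> be a quasi-inverse of \<open>F\<close>. An equivalence between additive categories is
  automatically additive, and an additive structure can be pulled back along \<open>G\<close>. Put
  \<open>\<Sigma>' = F \<Sigma> G\<close>; the unit of the equivalence yields \<open>\<Phi>: G \<Sigma>' \<cong> \<Sigma> G\<close>, so \<open>G\<close> sends a
  \<open>\<Sigma>'\<close>-sequence \<open>X\<close> to a \<open>\<Sigma>\<close>-sequence \<open>K X\<close>. Declaring \<open>X\<close> an angle iff \<open>K X\<close> is one
  reduces every axiom to the same axiom in \<open>\<C>\<close>, since \<open>K\<close> is fully faithful, preserves
  direct sums and cones, commutes with rotation up to isomorphism, and the class of angles is
  closed under isomorphism. Finally \<open>K (F X) \<cong> X\<close> through the unit, so \<open>F\<close> preserves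
  angles.\<close>

section \<open>Categories and functors\<close>

text \<open>Since \<open>\<Sigma>\<close> is only an autoequivalence, \<open>G \<Sigma>'\<close> and
  \<open>\<Sigma> G\<close> agree merely up to \<open>\<Phi>\<close>, so every axiom that mentions
  the suspension acquires a correction in its last position. Pulling the class of angles back along
  \<open>K\<close>, instead of taking images under \<open>F\<close>, makes membership a condition on
  a single sequence and builds closure under isomorphism into the definition. Two axioms still
  resist. (F1)(c) prescribes the first morphism on the nose, whereas essential surjectivity supplies
  objects only up to isomorphism. (F4) concerns every choice of biproducts, and its cone ends in the
  suspension of the first of them, so the biproducts used in \<open>\<C>\<close> have to be adapted
  to \<open>\<Phi>\<close>. The addition on \<open>\<C>'\<close> is a given one and need not be the
  one pulled back along \<open>G\<close>. Additivity of \<open>G\<close> must therefore be extracted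
  from categorical data: sums are recovered from biproducts, whose preservation has to be proved
  without any additivity.\<close>

lemma HomD:
  assumes "f \<in> Hom C X Y"
  shows "f \<in> Mor C" "Src C f = X" "Tgt C f = Y"
  using assms by (simp_all add: Hom_def)

context category
begin

text \<open>In terms of \<open>Hom\<close>, the intermediate objects of a composite would be free
  variables of the premises. With \<open>Mor\<close>, \<open>Src\<close> and \<open>Tgt\<close> the
  typing conditions become equations that rewriting can discharge.\<close>

lemma Cmp_arrow [simp]:
  assumes "f \<in> Mor C" "g \<in> Mor C" "Tgt C f = Src C g"
  shows "g \<cdot> f \<in> Mor C" "Src C (g \<cdot> f) = Src C f" "Tgt C (g \<cdot> f) = Tgt C g"
  using Cmp_Hom[of f "Src C f" "Src C g" g "Tgt C g"] assms by (auto simp: Hom_def)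

lemma Cmp_arrow_assoc [simp]:
  assumes "f \<in> Mor C" "g \<in> Mor C" "h \<in> Mor C" "Tgt C f = Src C g" "Tgt C g = Src C h"
  shows "(h \<cdot> g) \<cdot> f = h \<cdot> (g \<cdot> f)"
  using Cmp_assoc[of f "Src C f" "Src C g" g "Src C h" h "Tgt C h"] assms by (auto simp: Hom_def)

lemma Idn_arrow [simp]:
  assumes "X \<in> Ob C"
  shows "Idn C X \<in> Mor C" "Src C (Idn C X) = X" "Tgt C (Idn C X) = X"
  using Idn_Hom[OF assms] by (auto simp: Hom_def)

lemma Idn_arrow_left [simp]: "\<lbrakk>f \<in> Mor C; Tgt C f = X\<rbrakk> \<Longrightarrow> Idn C X \<cdot> f = f"
  using Cmp_Idn_left[of f "Src C f" X] by (simp add: Hom_def)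

lemma Idn_arrow_right [simp]: "\<lbrakk>f \<in> Mor C; Src C f = X\<rbrakk> \<Longrightarrow> f \<cdot> Idn C X = f"
  using Cmp_Idn_right[of f X "Tgt C f"] by (simp add: Hom_def)

text \<open>Rewriting nests composites to the right, so \<open>v \<cdot> u\<close> does not occur as
  a subterm of a longer composite; the cancellation has to be stated with a tail
  \<open>x\<close>.\<close>

lemma Cmp_cancel:
  assumes "v \<cdot> u = Idn C X" "u \<in> Mor C" "v \<in> Mor C" "Src C v = Tgt C u" "Src C u = X"
    and "x \<in> Mor C" "Tgt C x = X"
  shows "v \<cdot> (u \<cdot> x) = x"
  using Cmp_arrow_assoc[of x u v] assms by simp

lemma isoE:
  assumes "isomorphism_in C u"
  obtains v where "u \<in> Mor C" "v \<in> Mor C" "Src C v = Tgt C u" "Tgt C v = Src C u"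
    "v \<cdot> u = Idn C (Src C u)" "u \<cdot> v = Idn C (Tgt C u)"
  using assms unfolding isomorphism_in_def by (auto simp: Hom_def)

lemma isoI:
  assumes "u \<in> Mor C" "v \<in> Mor C" "Src C v = Tgt C u" "Tgt C v = Src C u"
    "v \<cdot> u = Idn C (Src C u)" "u \<cdot> v = Idn C (Tgt C u)"
  shows "isomorphism_in C u"
  using assms unfolding isomorphism_in_def by (auto simp: Hom_def)

lemma iso_Idn: "X \<in> Ob C \<Longrightarrow> isomorphism_in C (Idn C X)"
  by (rule isoI[of _ "Idn C X"]) simp_all

lemma iso_Cmp:
  assumes "isomorphism_in C u" "isomorphism_in C w" "Tgt C u = Src C w"
  shows "isomorphism_in C (w \<cdot> u)"
proof -
  obtain v where v: "u \<in> Mor C" "v \<in> Mor C" "Src C v = Tgt C u" "Tgt C v = Src C u"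
    "v \<cdot> u = Idn C (Src C u)" "u \<cdot> v = Idn C (Tgt C u)"
    using assms(1) by (rule isoE)
  obtain x where x: "w \<in> Mor C" "x \<in> Mor C" "Src C x = Tgt C w" "Tgt C x = Src C w"
    "x \<cdot> w = Idn C (Src C w)" "w \<cdot> x = Idn C (Tgt C w)"
    using assms(2) by (rule isoE)
  have 1: "x \<cdot> (w \<cdot> u) = u"
    by (rule Cmp_cancel) (use v x assms(3) in simp_all)
  have 2: "u \<cdot> (v \<cdot> x) = x"
    by (rule Cmp_cancel) (use v x assms(3) in simp_all)
  show ?thesis
    by (rule isoI[of _ "v \<cdot> x"]) (use v x assms(3) 1 2 in simp_all)
qed

end

section \<open>Functors, natural isomorphisms and equivalences\<close>

lemma functor_arrow:
  assumes "is_functor C D F"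
  shows "X \<in> Ob C \<Longrightarrow> Fob F X \<in> Ob D"
    and "f \<in> Mor C \<Longrightarrow> Fmor F f \<in> Mor D"
    and "f \<in> Mor C \<Longrightarrow> Src D (Fmor F f) = Fob F (Src C f)"
    and "f \<in> Mor C \<Longrightarrow> Tgt D (Fmor F f) = Fob F (Tgt C f)"
    and "X \<in> Ob C \<Longrightarrow> Fmor F (Idn C X) = Idn D (Fob F X)"
    and "\<lbrakk>f \<in> Mor C; g \<in> Mor C; Tgt C f = Src C g\<rbrakk>
           \<Longrightarrow> Fmor F (g \<cdot>\<^bsub>C\<^esub> f) = Fmor F g \<cdot>\<^bsub>D\<^esub> Fmor F f"
  using assms unfolding is_functor_def Hom_def by auto

lemma functor_id: "category C \<Longrightarrow> is_functor C C id_functor"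
  by (auto simp: is_functor_def id_functor_def)

lemma functor_comp:
  assumes "is_functor C D F" "is_functor D E G"
  shows "is_functor C E (comp_functor G F)"
  using assms unfolding is_functor_def comp_functor_def by (auto; blast)

lemma Fob_comp [simp]: "Fob (comp_functor G F) X = Fob G (Fob F X)"
  and Fmor_comp [simp]: "Fmor (comp_functor G F) f = Fmor G (Fmor F f)"
  by (simp_all add: comp_functor_def)

lemma Fob_id [simp]: "Fob id_functor X = X"
  and Fmor_id [simp]: "Fmor id_functor f = f"
  by (simp_all add: id_functor_def)

lemma functor_iso:
  assumes "category C" "category D" "is_functor C D F" "isomorphism_in C u"
  shows "isomorphism_in D (Fmor F u)"
proof -
  interpret C: category C by fact
  interpret D: category D by fact
  note [simp] = functor_arrow[OF assms(3)] C.Src_Ob C.Tgt_Ob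
  obtain v where v: "u \<in> Mor C" "v \<in> Mor C" "Src C v = Tgt C u" "Tgt C v = Src C u"
    "v \<cdot>\<^bsub>C\<^esub> u = Idn C (Src C u)" "u \<cdot>\<^bsub>C\<^esub> v = Idn C (Tgt C u)"
    using assms(4) by (rule C.isoE)
  show ?thesis
    by (rule D.isoI[of _ "Fmor F v"])
      (use v functor_arrow(6)[OF assms(3), of u v] functor_arrow(6)[OF assms(3), of v u] in simp_all)
qed

lemma natural_iso_arrow:
  assumes "natural_iso C D F G \<theta>"
  shows "X \<in> Ob C \<Longrightarrow> \<theta> X \<in> Mor D"
    and "X \<in> Ob C \<Longrightarrow> Src D (\<theta> X) = Fob F X"
    and "X \<in> Ob C \<Longrightarrow> Tgt D (\<theta> X) = Fob G X"
    and "X \<in> Ob C \<Longrightarrow> isomorphism_in D (\<theta> X)"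
    and "f \<in> Mor C \<Longrightarrow> \<theta> (Tgt C f) \<cdot>\<^bsub>D\<^esub> Fmor F f = Fmor G f \<cdot>\<^bsub>D\<^esub> \<theta> (Src C f)"
  using assms unfolding natural_iso_def Hom_def by auto

lemma natural_isoI:
  assumes "\<And>X. X \<in> Ob C \<Longrightarrow> \<theta> X \<in> Mor D"
    and "\<And>X. X \<in> Ob C \<Longrightarrow> Src D (\<theta> X) = Fob F X"
    and "\<And>X. X \<in> Ob C \<Longrightarrow> Tgt D (\<theta> X) = Fob G X"
    and "\<And>X. X \<in> Ob C \<Longrightarrow> isomorphism_in D (\<theta> X)"
    and "\<And>f. f \<in> Mor C \<Longrightarrow> \<theta> (Tgt C f) \<cdot>\<^bsub>D\<^esub> Fmor F f = Fmor G f \<cdot>\<^bsub>D\<^esub> \<theta> (Src C f)"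
  shows "natural_iso C D F G \<theta>"
  using assms unfolding natural_iso_def Hom_def by auto

lemma natural_iso_inverse:
  assumes "category C" "category D" "is_functor C D F" "is_functor C D G" "natural_iso C D F G \<theta>"
  obtains \<phi> where "natural_iso C D G F \<phi>"
    "\<And>X. X \<in> Ob C \<Longrightarrow> \<phi> X \<cdot>\<^bsub>D\<^esub> \<theta> X = Idn D (Fob F X)"
    "\<And>X. X \<in> Ob C \<Longrightarrow> \<theta> X \<cdot>\<^bsub>D\<^esub> \<phi> X = Idn D (Fob G X)"
proof -
  interpret C: category C by fact
  interpret D: category D by fact
  note [simp] = functor_arrow[OF assms(3)] functor_arrow[OF assms(4)] C.Src_Ob C.Tgt_Ob
    natural_iso_arrow(1-3)[OF assms(5)]
  have "\<exists>v. v \<in> Mor D \<and> Src D v = Fob G X \<and> Tgt D v = Fob F X \<and>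
     v \<cdot>\<^bsub>D\<^esub> \<theta> X = Idn D (Fob F X) \<and> \<theta> X \<cdot>\<^bsub>D\<^esub> v = Idn D (Fob G X)" if "X \<in> Ob C" for X
    by (rule D.isoE[OF natural_iso_arrow(4)[OF assms(5) that]]) (use that in auto)
  then obtain \<phi> where \<phi>: "\<phi> X \<in> Mor D" "Src D (\<phi> X) = Fob G X" "Tgt D (\<phi> X) = Fob F X"
     "\<phi> X \<cdot>\<^bsub>D\<^esub> \<theta> X = Idn D (Fob F X)" "\<theta> X \<cdot>\<^bsub>D\<^esub> \<phi> X = Idn D (Fob G X)" if "X \<in> Ob C" for X
    by metis
  have "natural_iso C D G F \<phi>"
  proof (rule natural_isoI)
    fix X assume X: "X \<in> Ob C"
    show "isomorphism_in D (\<phi> X)"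
      by (rule D.isoI[of _ "\<theta> X"]) (use X \<phi>[OF X] in simp_all)
  next
    fix f assume f: "f \<in> Mor C"
    let ?X = "Src C f" and ?Y = "Tgt C f"
    have o: "?X \<in> Ob C" "?Y \<in> Ob C" using f by simp_all
    note [simp] = f \<phi>[OF o(1)] \<phi>[OF o(2)]
    \<comment> \<open>The identity is inserted in the form \<open>\<theta> ?X\<close> after
      \<open>\<phi> ?X\<close>, so that naturality of \<open>\<theta>\<close> applies in the
      middle.\<close>
    have "\<phi> ?Y \<cdot>\<^bsub>D\<^esub> Fmor G f = \<phi> ?Y \<cdot>\<^bsub>D\<^esub> ((Fmor G f \<cdot>\<^bsub>D\<^esub> \<theta> ?X) \<cdot>\<^bsub>D\<^esub> \<phi> ?X)"
      by simp
    also have "\<dots> = \<phi> ?Y \<cdot>\<^bsub>D\<^esub> ((\<theta> ?Y \<cdot>\<^bsub>D\<^esub> Fmor F f) \<cdot>\<^bsub>D\<^esub> \<phi> ?X)"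
      by (simp only: natural_iso_arrow(5)[OF assms(5) f])
    also have "\<dots> = \<phi> ?Y \<cdot>\<^bsub>D\<^esub> \<theta> ?Y \<cdot>\<^bsub>D\<^esub> Fmor F f \<cdot>\<^bsub>D\<^esub> \<phi> ?X"
      by simp
    also have "\<dots> = Fmor F f \<cdot>\<^bsub>D\<^esub> \<phi> ?X"
      by (rule D.Cmp_cancel[OF \<phi>(4)[OF o(2)]]) simp_all
    finally show "\<phi> ?Y \<cdot>\<^bsub>D\<^esub> Fmor G f = Fmor F f \<cdot>\<^bsub>D\<^esub> \<phi> ?X" .
  qed (use \<phi> in auto)
  then show ?thesis using \<phi> that by blast
qed

text \<open>The unit of a composite: \<open>X \<rightarrow> G F X \<rightarrow> G K H F X\<close>,
  with \<open>\<kappa>\<close> taken at \<open>F X\<close> and pushed forward by \<open>G\<close>.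
  Only isomorphisms leaving the identity occur, so that exchanging the roles of the functors also
  gives the isomorphism on the other side.\<close>

lemma natural_iso_sandwich:
  assumes "category C" "category D" "category E" "is_functor C D F" "is_functor D C G"
    "is_functor D E H" "is_functor E D K"
    and \<eta>: "natural_iso C C id_functor (comp_functor G F) \<eta>"
    and \<kappa>: "natural_iso D D id_functor (comp_functor K H) \<kappa>"
  shows "natural_iso C C id_functor (comp_functor (comp_functor G K) (comp_functor H F))
           (\<lambda>X. Fmor G (\<kappa> (Fob F X)) \<cdot>\<^bsub>C\<^esub> \<eta> X)"
proof -
  interpret C: category C by fact
  interpret D: category D by fact
  interpret E: category E by fact
  note [simp] = functor_arrow[OF assms(4)] functor_arrow[OF assms(5)] functor_arrow[OF assms(6)]
    functor_arrow[OF assms(7)] C.Src_Ob C.Tgt_Ob D.Src_Ob D.Tgt_Ob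
    natural_iso_arrow(1-4)[OF \<eta>] natural_iso_arrow(1-4)[OF \<kappa>]
  show ?thesis
  proof (rule natural_isoI)
    fix X assume "X \<in> Ob C"
    then show "isomorphism_in C (Fmor G (\<kappa> (Fob F X)) \<cdot>\<^bsub>C\<^esub> \<eta> X)"
      by (intro C.iso_Cmp functor_iso[OF assms(2,1,5)]) simp_all
  next
    fix f assume f: "f \<in> Mor C"
    let ?X = "Src C f" and ?Y = "Tgt C f"
    note [simp] = f
    have *: "\<eta> ?Y \<cdot>\<^bsub>C\<^esub> f = Fmor G (Fmor F f) \<cdot>\<^bsub>C\<^esub> \<eta> ?X"
      using natural_iso_arrow(5)[OF \<eta> f] by simp
    have "\<kappa> (Fob F ?Y) \<cdot>\<^bsub>D\<^esub> Fmor F f = Fmor K (Fmor H (Fmor F f)) \<cdot>\<^bsub>D\<^esub> \<kappa> (Fob F ?X)"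
      using natural_iso_arrow(5)[OF \<kappa>, of "Fmor F f"] by simp
    then have "Fmor G (\<kappa> (Fob F ?Y) \<cdot>\<^bsub>D\<^esub> Fmor F f)
        = Fmor G (Fmor K (Fmor H (Fmor F f)) \<cdot>\<^bsub>D\<^esub> \<kappa> (Fob F ?X))" by simp
    then have "Fmor G (\<kappa> (Fob F ?Y)) \<cdot>\<^bsub>C\<^esub> Fmor G (Fmor F f)
        = Fmor G (Fmor K (Fmor H (Fmor F f))) \<cdot>\<^bsub>C\<^esub> Fmor G (\<kappa> (Fob F ?X))" by simp
    then have "(Fmor G (\<kappa> (Fob F ?Y)) \<cdot>\<^bsub>C\<^esub> Fmor G (Fmor F f)) \<cdot>\<^bsub>C\<^esub> \<eta> ?X
        = (Fmor G (Fmor K (Fmor H (Fmor F f))) \<cdot>\<^bsub>C\<^esub> Fmor G (\<kappa> (Fob F ?X))) \<cdot>\<^bsub>C\<^esub> \<eta> ?X"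
      by (rule arg_cong)
    then show "(Fmor G (\<kappa> (Fob F ?Y)) \<cdot>\<^bsub>C\<^esub> \<eta> ?Y) \<cdot>\<^bsub>C\<^esub> Fmor id_functor f =
         Fmor (comp_functor (comp_functor G K) (comp_functor H F)) f
           \<cdot>\<^bsub>C\<^esub> Fmor G (\<kappa> (Fob F ?X)) \<cdot>\<^bsub>C\<^esub> \<eta> ?X"
      by (simp add: *)
  qed simp_all
qed

text \<open>With both isomorphisms pointing away from the identity the notion becomes symmetric.\<close>

lemma is_equivalence_iff:
  assumes "category C" "category D"
  shows "is_equivalence C D F \<longleftrightarrow> is_functor C D F \<and> (\<exists>G \<eta> \<kappa>. is_functor D C G \<and>
        natural_iso C C id_functor (comp_functor G F) \<eta> \<and>
        natural_iso D D id_functor (comp_functor F G) \<kappa>)"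
proof -
  have "(\<exists>\<epsilon>. natural_iso D D (comp_functor F G) id_functor \<epsilon>) \<longleftrightarrow>
    (\<exists>\<kappa>. natural_iso D D id_functor (comp_functor F G) \<kappa>)"
    if "is_functor C D F" "is_functor D C G" for G
    using natural_iso_inverse[OF assms(2,2)] functor_id[OF assms(2)]
      functor_comp[OF that(2) that(1)] by metis
  then show ?thesis unfolding is_equivalence_def by blast
qed

text \<open>Needed to see that the transported suspension, a composite of three equivalences, is an
  autoequivalence.\<close>

lemma is_equivalence_comp:
  assumes "category C" "category D" "category E" "is_equivalence C D F" "is_equivalence D E H"
  shows "is_equivalence C E (comp_functor H F)"
proof -
  obtain G \<eta> \<kappa> where 1: "is_functor C D F" "is_functor D C G"
    "natural_iso C C id_functor (comp_functor G F) \<eta>"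
    "natural_iso D D id_functor (comp_functor F G) \<kappa>"
    using assms(4) is_equivalence_iff[OF assms(1,2)] by blast
  obtain K \<mu> \<nu> where 2: "is_functor D E H" "is_functor E D K"
    "natural_iso D D id_functor (comp_functor K H) \<mu>"
    "natural_iso E E id_functor (comp_functor H K) \<nu>"
    using assms(5) is_equivalence_iff[OF assms(2,3)] by blast
  show ?thesis
    unfolding is_equivalence_iff[OF assms(1,3)]
    using functor_comp[OF 1(1) 2(1)] functor_comp[OF 2(2) 1(2)]
      natural_iso_sandwich[OF assms(1,2,3) 1(1,2) 2(1,2) 1(3) 2(3)]
      natural_iso_sandwich[OF assms(3,2,1) 2(2,1) 1(2,1) 2(4) 1(4)] by blast
qed

text \<open>Transport uses an equivalence only through lifts of morphisms, uniqueness of these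
  lifts, and objects up to isomorphism. Isolating these properties lets the results apply to
  \<open>F\<close>, to its quasi-inverse and to both suspensions alike.\<close>

locale ff_ess_surj = dom: category D + cod: category C
  for D :: "('p, 'q) cat" and C :: "('o, 'm) cat" +
  fixes G :: "('p, 'q, 'o, 'm) cat_functor"
  assumes G: "is_functor D C G"
    and full: "\<lbrakk>X \<in> Ob D; Y \<in> Ob D; h \<in> Mor C; Src C h = Fob G X; Tgt C h = Fob G Y\<rbrakk>
          \<Longrightarrow> \<exists>f \<in> Mor D. Src D f = X \<and> Tgt D f = Y \<and> Fmor G f = h"
    and faithful: "\<lbrakk>Fmor G f = Fmor G g; f \<in> Mor D; g \<in> Mor D; Src D f = Src D g;
          Tgt D f = Tgt D g\<rbrakk> \<Longrightarrow> f = g"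
    and ess_surj: "Z \<in> Ob C \<Longrightarrow> \<exists>Y u. Y \<in> Ob D \<and> isomorphism_in C u \<and> Src C u = Fob G Y \<and> Tgt C u = Z"
begin

lemmas G_arrow [simp] = functor_arrow[OF G]

declare dom.Src_Ob [simp] dom.Tgt_Ob [simp] cod.Src_Ob [simp] cod.Tgt_Ob [simp]

end

text \<open>Naturality expresses \<open>\<eta>\<close> after \<open>f\<close> through
  \<open>G (F f)\<close>, and \<open>\<eta>\<close> at the target can be cancelled, so
  \<open>f\<close> is determined by \<open>F f\<close>. Applied to \<open>\<kappa>\<close>, the same
  argument shows that \<open>G\<close> is faithful.\<close>

lemma unit_imp_faithful:
  assumes "category C" "category D" "is_functor C D F" "is_functor D C G"
    and \<eta>: "natural_iso C C id_functor (comp_functor G F) \<eta>"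
    and "Fmor F f = Fmor F g" "f \<in> Mor C" "g \<in> Mor C" "Src C f = Src C g" "Tgt C f = Tgt C g"
  shows "f = g"
proof -
  interpret C: category C by fact
  note [simp] = functor_arrow[OF assms(3)] functor_arrow[OF assms(4)] C.Src_Ob C.Tgt_Ob
    natural_iso_arrow(1-3)[OF \<eta>] assms(7-10)
  obtain v where v: "v \<in> Mor C" "Src C v = Tgt C (\<eta> (Tgt C g))" "Tgt C v = Tgt C g"
    "v \<cdot>\<^bsub>C\<^esub> \<eta> (Tgt C g) = Idn C (Tgt C g)"
    by (rule C.isoE[OF natural_iso_arrow(4)[OF \<eta>, of "Tgt C g"]]) simp_all
  have "\<eta> (Tgt C g) \<cdot>\<^bsub>C\<^esub> f = \<eta> (Tgt C g) \<cdot>\<^bsub>C\<^esub> g"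
    using natural_iso_arrow(5)[OF \<eta>, of f] natural_iso_arrow(5)[OF \<eta>, of g] assms(6) by simp
  moreover have "v \<cdot>\<^bsub>C\<^esub> (\<eta> (Tgt C g) \<cdot>\<^bsub>C\<^esub> f) = f"
    by (rule C.Cmp_cancel[OF v(4)]) (simp_all add: v(1-3))
  moreover have "v \<cdot>\<^bsub>C\<^esub> (\<eta> (Tgt C g) \<cdot>\<^bsub>C\<^esub> g) = g"
    by (rule C.Cmp_cancel[OF v(4)]) (simp_all add: v(1-3))
  ultimately show ?thesis by metis
qed

lemma is_equivalence_imp_ff_ess_surj:
  assumes "category C" "category D" "is_equivalence C D F"
  shows "ff_ess_surj C D F"
proof -
  interpret C: category C by fact
  interpret D: category D by fact
  obtain G \<eta> \<kappa> where F: "is_functor C D F" and G: "is_functor D C G"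
    and \<eta>: "natural_iso C C id_functor (comp_functor G F) \<eta>"
    and \<kappa>: "natural_iso D D id_functor (comp_functor F G) \<kappa>"
    using assms(3) is_equivalence_iff[OF assms(1,2)] by blast
  note [simp] = functor_arrow[OF F] functor_arrow[OF G] C.Src_Ob C.Tgt_Ob D.Src_Ob D.Tgt_Ob
    natural_iso_arrow(1-3)[OF \<eta>] natural_iso_arrow(1-3)[OF \<kappa>]
  obtain \<phi> where \<phi>: "natural_iso C C (comp_functor G F) id_functor \<phi>"
    "\<And>X. X \<in> Ob C \<Longrightarrow> \<phi> X \<cdot>\<^bsub>C\<^esub> \<eta> X = Idn C X"
    "\<And>X. X \<in> Ob C \<Longrightarrow> \<eta> X \<cdot>\<^bsub>C\<^esub> \<phi> X = Idn C (Fob G (Fob F X))"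
    by (rule natural_iso_inverse[OF assms(1,1) functor_id[OF assms(1)] functor_comp[OF F G] \<eta>])
      simp
  obtain \<epsilon> where \<epsilon>: "natural_iso D D (comp_functor F G) id_functor \<epsilon>"
    by (rule natural_iso_inverse[OF assms(2,2) functor_id[OF assms(2)] functor_comp[OF G F] \<kappa>])
  note [simp] = natural_iso_arrow(1-3)[OF \<phi>(1)] natural_iso_arrow(1-3)[OF \<epsilon>]
  show ?thesis
  proof
    fix X Y g
    assume [simp]: "X \<in> Ob C" "Y \<in> Ob C" "g \<in> Mor D" "Src D g = Fob F X" "Tgt D g = Fob F Y"
    \<comment> \<open>The only candidate: naturality of \<open>\<eta>\<close> forces a preimage of
      \<open>g\<close> to be \<open>G g\<close> conjugated by the unit.\<close>
    define f where "f = \<phi> Y \<cdot>\<^bsub>C\<^esub> Fmor G g \<cdot>\<^bsub>C\<^esub> \<eta> X"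
    have [simp]: "f \<in> Mor C" "Src C f = X" "Tgt C f = Y" by (simp_all add: f_def)
    have "\<eta> Y \<cdot>\<^bsub>C\<^esub> f = Fmor G (Fmor F f) \<cdot>\<^bsub>C\<^esub> \<eta> X"
      using natural_iso_arrow(5)[OF \<eta>, of f] by simp
    moreover have "\<eta> Y \<cdot>\<^bsub>C\<^esub> f = Fmor G g \<cdot>\<^bsub>C\<^esub> \<eta> X"
      unfolding f_def by (rule C.Cmp_cancel[OF \<phi>(3)]) simp_all
    ultimately have "(Fmor G (Fmor F f) \<cdot>\<^bsub>C\<^esub> \<eta> X) \<cdot>\<^bsub>C\<^esub> \<phi> X = (Fmor G g \<cdot>\<^bsub>C\<^esub> \<eta> X) \<cdot>\<^bsub>C\<^esub> \<phi> X"
      by simp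
    then have "Fmor G (Fmor F f) = Fmor G g" by (simp add: \<phi>(3))
    \<comment> \<open>Faithfulness of \<open>G\<close>, which comes from \<open>\<kappa>\<close>,
      removes the outer \<open>G\<close>.\<close>
    then have "Fmor F f = g"
      by (rule unit_imp_faithful[OF assms(2,1) G F \<kappa>]) simp_all
    then show "\<exists>f \<in> Mor C. Src C f = X \<and> Tgt C f = Y \<and> Fmor F f = g"
      by (intro bexI[of _ f]) simp_all
  next
    fix X assume "X \<in> Ob D"
    then show "\<exists>Y u. Y \<in> Ob C \<and> isomorphism_in D u \<and> Src D u = Fob F Y \<and> Tgt D u = X"
      using natural_iso_arrow(4)[OF \<epsilon>] by (intro exI[of _ "Fob G X"] exI[of _ "\<epsilon> X"]) simp
  qed (use unit_imp_faithful[OF assms(1,2) F G \<eta>] F in blast)+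
qed

section \<open>Additive structure\<close>

text \<open>The arithmetic of the Hom groups is separated from the existence of zero objects and
  biproducts, because for a pulled-back addition it is already used to exhibit a zero
  object.\<close>

locale preadditive_category = category C
  for C :: "('o, 'm) cat" (structure) +
  fixes A :: "('o, 'm) hom_addition"
  assumes Hom_group: "\<lbrakk>X \<in> Ob C; Y \<in> Ob C\<rbrakk> \<Longrightarrow> comm_group (Hom_group C A X Y)"
    and distrib_left: "\<lbrakk>f \<in> Hom C X Y; g \<in> Hom C Y Z; h \<in> Hom C Y Z\<rbrakk>
                         \<Longrightarrow> Add A g h \<cdot> f = Add A (g \<cdot> f) (h \<cdot> f)"
    and distrib_right: "\<lbrakk>f \<in> Hom C X Y; g \<in> Hom C X Y; h \<in> Hom C Y Z\<rbrakk>
                         \<Longrightarrow> h \<cdot> Add A f g = Add A (h \<cdot> f) (h \<cdot> g)"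
begin

lemma Hom_group_arrow: "f \<in> Mor C \<Longrightarrow> comm_group (Hom_group C A (Src C f) (Tgt C f))"
  using Hom_group Src_Ob Tgt_Ob by blast

lemma Add_arrow [simp]:
  assumes "f \<in> Mor C" "g \<in> Mor C" "Src C f = Src C g" "Tgt C f = Tgt C g"
  shows "Add A f g \<in> Mor C" "Src C (Add A f g) = Src C g" "Tgt C (Add A f g) = Tgt C g"
proof -
  interpret M: comm_group "Hom_group C A (Src C g) (Tgt C g)"
    using Hom_group_arrow assms by blast
  have "Add A f g \<in> Hom C (Src C g) (Tgt C g)"
    using M.m_closed[of f g] assms by (simp add: Hom_group_def Hom_def)
  then show "Add A f g \<in> Mor C" "Src C (Add A f g) = Src C g" "Tgt C (Add A f g) = Tgt C g"
    by (simp_all add: Hom_def)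
qed

lemma Zero_arrow [simp]:
  assumes "X \<in> Ob C" "Y \<in> Ob C"
  shows "Zero A X Y \<in> Mor C" "Src C (Zero A X Y) = X" "Tgt C (Zero A X Y) = Y"
proof -
  interpret M: comm_group "Hom_group C A X Y" using Hom_group assms by blast
  have "Zero A X Y \<in> Hom C X Y"
    using M.one_closed by (simp add: Hom_group_def)
  then show "Zero A X Y \<in> Mor C" "Src C (Zero A X Y) = X" "Tgt C (Zero A X Y) = Y"
    by (simp_all add: Hom_def)
qed

lemma Neg_arrow [simp]:
  assumes "f \<in> Mor C"
  shows "Neg C A f \<in> Mor C" "Src C (Neg C A f) = Src C f" "Tgt C (Neg C A f) = Tgt C f"
    and "Add A f (Neg C A f) = Zero A (Src C f) (Tgt C f)"
proof -
  interpret M: comm_group "Hom_group C A (Src C f) (Tgt C f)"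
    using Hom_group_arrow assms by blast
  have "f \<in> carrier (Hom_group C A (Src C f) (Tgt C f))"
    using assms by (simp add: Hom_group_def Hom_def)
  from M.inv_closed[OF this] M.r_inv[OF this]
  show "Neg C A f \<in> Mor C" "Src C (Neg C A f) = Src C f" "Tgt C (Neg C A f) = Tgt C f"
    "Add A f (Neg C A f) = Zero A (Src C f) (Tgt C f)"
    by (simp_all add: Hom_group_def Hom_def Neg_def)
qed

lemma Add_Zero_left [simp]:
  assumes "f \<in> Mor C" "Src C f = X" "Tgt C f = Y"
  shows "Add A (Zero A X Y) f = f"
proof -
  interpret M: comm_group "Hom_group C A X Y" using Hom_group_arrow assms by blast
  show ?thesis using M.l_one[of f] assms by (simp add: Hom_group_def Hom_def)
qed

lemma Add_commute:
  assumes "f \<in> Mor C" "g \<in> Mor C" "Src C f = Src C g" "Tgt C f = Tgt C g"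
  shows "Add A f g = Add A g f"
proof -
  interpret M: comm_group "Hom_group C A (Src C f) (Tgt C f)"
    using Hom_group_arrow assms by blast
  show ?thesis using M.m_comm[of f g] assms by (simp add: Hom_group_def Hom_def)
qed

lemma Add_Zero_right [simp]:
  assumes "f \<in> Mor C" "Src C f = X" "Tgt C f = Y"
  shows "Add A f (Zero A X Y) = f"
  using Add_Zero_left[OF assms] Add_commute[of f "Zero A X Y"] assms Src_Ob Tgt_Ob by auto

lemma Add_left_cancel:
  assumes "Add A f g = Add A f h" "f \<in> Mor C" "g \<in> Mor C" "h \<in> Mor C"
    "Src C f = Src C g" "Tgt C f = Tgt C g" "Src C f = Src C h" "Tgt C f = Tgt C h"
  shows "g = h"
proof -
  interpret M: comm_group "Hom_group C A (Src C f) (Tgt C f)"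
    using Hom_group_arrow assms by blast
  show ?thesis using M.Units_l_cancel[of f g h, unfolded M.Units_eq] assms by (simp add: Hom_group_def Hom_def)
qed

lemma Add_assoc':
  assumes "f \<in> Mor C" "g \<in> Mor C" "h \<in> Mor C"
    "Src C f = Src C g" "Tgt C f = Tgt C g" "Src C f = Src C h" "Tgt C f = Tgt C h"
  shows "Add A (Add A f g) h = Add A f (Add A g h)"
proof -
  interpret M: comm_group "Hom_group C A (Src C f) (Tgt C f)"
    using Hom_group_arrow assms by blast
  show ?thesis using M.m_assoc[of f g h] assms by (simp add: Hom_group_def Hom_def)
qed

lemma Neg_unique:
  assumes "Add A f g = Zero A (Src C f) (Tgt C f)" "f \<in> Mor C" "g \<in> Mor C"
    "Src C f = Src C g" "Tgt C f = Tgt C g"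
  shows "g = Neg C A f"
  by (rule Add_left_cancel[of f]) (use assms in simp_all)

lemma Add_Cmp [simp]:
  assumes "f \<in> Mor C" "g \<in> Mor C" "h \<in> Mor C" "Tgt C f = Src C g" "Src C g = Src C h" "Tgt C g = Tgt C h"
  shows "Add A g h \<cdot> f = Add A (g \<cdot> f) (h \<cdot> f)"
  using distrib_left[of f "Src C f" "Src C g" g "Tgt C g" h] assms by (simp add: Hom_def)

lemma Cmp_Add [simp]:
  assumes "f \<in> Mor C" "g \<in> Mor C" "h \<in> Mor C" "Src C f = Src C g" "Tgt C f = Tgt C g" "Tgt C g = Src C h"
  shows "h \<cdot> Add A f g = Add A (h \<cdot> f) (h \<cdot> g)"
  using distrib_right[of f "Src C f" "Tgt C f" g h "Tgt C h"] assms by (simp add: Hom_def)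

lemma Cmp_Zero [simp]:
  assumes "g \<in> Mor C" "Src C g = Y" "X \<in> Ob C"
  shows "g \<cdot> Zero A X Y = Zero A X (Tgt C g)"
proof -
  have [simp]: "Y \<in> Ob C" "Tgt C g \<in> Ob C" using assms Src_Ob Tgt_Ob by auto
  have "Add A (g \<cdot> Zero A X Y) (g \<cdot> Zero A X Y) = g \<cdot> Add A (Zero A X Y) (Zero A X Y)"
    by (subst Cmp_Add) (use assms in simp_all)
  also have "\<dots> = Add A (g \<cdot> Zero A X Y) (Zero A X (Tgt C g))"
    using assms by simp
  finally show ?thesis
    by (rule Add_left_cancel) (use assms in simp_all)
qed

lemma Zero_Cmp [simp]:
  assumes "f \<in> Mor C" "Tgt C f = X" "Y \<in> Ob C"
  shows "Zero A X Y \<cdot> f = Zero A (Src C f) Y"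
proof -
  have [simp]: "X \<in> Ob C" "Src C f \<in> Ob C" using assms Src_Ob Tgt_Ob by auto
  have "Add A (Zero A X Y \<cdot> f) (Zero A X Y \<cdot> f) = Add A (Zero A X Y) (Zero A X Y) \<cdot> f"
    by (subst Add_Cmp) (use assms in simp_all)
  also have "\<dots> = Add A (Zero A X Y \<cdot> f) (Zero A (Src C f) Y)"
    using assms by simp
  finally show ?thesis
    by (rule Add_left_cancel) (use assms in simp_all)
qed

lemma Cmp_Neg:
  assumes "f \<in> Mor C" "g \<in> Mor C" "Tgt C f = Src C g"
  shows "g \<cdot> Neg C A f = Neg C A (g \<cdot> f)"
proof (rule Neg_unique)
  have "Add A (g \<cdot> f) (g \<cdot> Neg C A f) = g \<cdot> Add A f (Neg C A f)"
    by (subst Cmp_Add) (use assms in simp_all)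
  then show "Add A (g \<cdot> f) (g \<cdot> Neg C A f) = Zero A (Src C (g \<cdot> f)) (Tgt C (g \<cdot> f))"
    using assms Src_Ob by simp
qed (use assms in simp_all)

lemma Neg_Cmp:
  assumes "f \<in> Mor C" "g \<in> Mor C" "Tgt C f = Src C g"
  shows "Neg C A g \<cdot> f = Neg C A (g \<cdot> f)"
proof (rule Neg_unique)
  have "Add A (g \<cdot> f) (Neg C A g \<cdot> f) = Add A g (Neg C A g) \<cdot> f"
    by (subst Add_Cmp) (use assms in simp_all)
  then show "Add A (g \<cdot> f) (Neg C A g \<cdot> f) = Zero A (Src C (g \<cdot> f)) (Tgt C (g \<cdot> f))"
    using assms Tgt_Ob by simp
qed (use assms in simp_all)

text \<open>If the identity of \<open>Z\<close> vanishes, so does every morphism into or out of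
  \<open>Z\<close>, being a composite with it. This turns a universal property into an equation,
  which a faithful functor can test.\<close>

lemma zero_object_iff: "zero_object C Z \<longleftrightarrow> Z \<in> Ob C \<and> Idn C Z = Zero A Z Z"
proof
  assume Z: "zero_object C Z"
  then have [simp]: "Z \<in> Ob C" by (simp add: zero_object_def)
  have "\<exists>!f. f \<in> Hom C Z Z" using Z by (simp add: zero_object_def)
  moreover have "Idn C Z \<in> Hom C Z Z" "Zero A Z Z \<in> Hom C Z Z" by (simp_all add: Hom_def)
  ultimately show "Z \<in> Ob C \<and> Idn C Z = Zero A Z Z" by auto
next
  assume Z: "Z \<in> Ob C \<and> Idn C Z = Zero A Z Z"
  have 1: "f = Zero A (Src C f) Z" if "f \<in> Mor C" "Tgt C f = Z" for f
    using Idn_arrow_left[OF that] Zero_Cmp[OF that] Z by metis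
  have 2: "f = Zero A Z (Tgt C f)" if "f \<in> Mor C" "Src C f = Z" for f
    using Idn_arrow_right[OF that] Cmp_Zero[OF that] Z by metis
  show "zero_object C Z"
    unfolding zero_object_def
  proof (intro conjI ballI ex_ex1I)
    fix X assume "X \<in> Ob C"
    then have "Zero A X Z \<in> Hom C X Z" "Zero A Z X \<in> Hom C Z X"
      using Z by (simp_all add: Hom_def)
    then show "\<exists>f. f \<in> Hom C X Z" "\<exists>f. f \<in> Hom C Z X" by blast+
  qed (use Z in blast, (metis 1 2 HomD)+)
qed

lemma into_zero_object:
  assumes "zero_object C Z" "f \<in> Mor C" "Tgt C f = Z"
  shows "f = Zero A (Src C f) Z"
  using Idn_arrow_left[OF assms(2,3)] Zero_Cmp[OF assms(2,3)] assms(1) zero_object_iff by metis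

end

sublocale additive_category \<subseteq> preadditive_category C A
  by (intro preadditive_category.intro preadditive_category_axioms.intro category_axioms)
    (fact Hom_comm_group Cmp_Add_left Cmp_Add_right)+

section \<open>Biproducts and transport of an additive structure\<close>

lemma (in category) is_biproduct_arrow:
  assumes "is_biproduct C A X Y B"
  shows "Bob B \<in> Ob C" "X \<in> Ob C" "Y \<in> Ob C"
    "In1 B \<in> Mor C" "Src C (In1 B) = X" "Tgt C (In1 B) = Bob B"
    "In2 B \<in> Mor C" "Src C (In2 B) = Y" "Tgt C (In2 B) = Bob B"
    "Pr1 B \<in> Mor C" "Src C (Pr1 B) = Bob B" "Tgt C (Pr1 B) = X"
    "Pr2 B \<in> Mor C" "Src C (Pr2 B) = Bob B" "Tgt C (Pr2 B) = Y"
    "Pr1 B \<cdot> In1 B = Idn C X" "Pr2 B \<cdot> In2 B = Idn C Y"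
    "Pr1 B \<cdot> In2 B = Zero A Y X" "Pr2 B \<cdot> In1 B = Zero A X Y"
    "Add A (In1 B \<cdot> Pr1 B) (In2 B \<cdot> Pr2 B) = Idn C (Bob B)"
  using assms Src_Ob unfolding is_biproduct_def Hom_def by auto

lemma (in category) is_biproductI:
  assumes "Bob B \<in> Ob C"
    "In1 B \<in> Mor C" "Src C (In1 B) = X" "Tgt C (In1 B) = Bob B"
    "In2 B \<in> Mor C" "Src C (In2 B) = Y" "Tgt C (In2 B) = Bob B"
    "Pr1 B \<in> Mor C" "Src C (Pr1 B) = Bob B" "Tgt C (Pr1 B) = X"
    "Pr2 B \<in> Mor C" "Src C (Pr2 B) = Bob B" "Tgt C (Pr2 B) = Y"
    "Pr1 B \<cdot> In1 B = Idn C X" "Pr2 B \<cdot> In2 B = Idn C Y"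
    "Pr1 B \<cdot> In2 B = Zero A Y X" "Pr2 B \<cdot> In1 B = Zero A X Y"
    "Add A (In1 B \<cdot> Pr1 B) (In2 B \<cdot> Pr2 B) = Idn C (Bob B)"
  shows "is_biproduct C A X Y B"
  using assms unfolding is_biproduct_def Hom_def by auto

locale ff_ess_surj_additive = ff_ess_surj D C G + cod: additive_category C A
  for D :: "('p, 'q) cat" and C :: "('o, 'm) cat" and G :: "('p, 'q, 'o, 'm) cat_functor"
    and A :: "('o, 'm) hom_addition"
begin

text \<open>When the endpoints of \<open>h\<close> are \<open>G X\<close> and \<open>G Y\<close>,
  the choice exists by fullness and is unique by faithfulness. The objects are arguments because
  \<open>G\<close> need not be injective on objects, so \<open>h\<close> alone does not determine
  them.\<close>

definition lift_mor :: "'p \<Rightarrow> 'p \<Rightarrow> 'm \<Rightarrow> 'q" where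
  "lift_mor X Y h = (SOME f. f \<in> Mor D \<and> Src D f = X \<and> Tgt D f = Y \<and> Fmor G f = h)"

lemma lift_mor [simp]:
  assumes "X \<in> Ob D" "Y \<in> Ob D" "h \<in> Mor C" "Src C h = Fob G X" "Tgt C h = Fob G Y"
  shows "lift_mor X Y h \<in> Mor D" "Src D (lift_mor X Y h) = X" "Tgt D (lift_mor X Y h) = Y"
    "Fmor G (lift_mor X Y h) = h"
  using someI_ex[OF full[OF assms, unfolded Bex_def]] unfolding lift_mor_def by auto

definition pullback_addition :: "('p, 'q) hom_addition" where
  "pullback_addition = \<lparr>
     Add = (\<lambda>f g. lift_mor (Src D f) (Tgt D f) (Add A (Fmor G f) (Fmor G g))),
     Zero = (\<lambda>X Y. lift_mor X Y (Zero A (Fob G X) (Fob G Y)))\<rparr>"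

lemma pullback_Add [simp]:
  assumes "f \<in> Mor D" "g \<in> Mor D" "Src D f = Src D g" "Tgt D f = Tgt D g"
  shows "Add pullback_addition f g \<in> Mor D" "Src D (Add pullback_addition f g) = Src D g"
    "Tgt D (Add pullback_addition f g) = Tgt D g"
    "Fmor G (Add pullback_addition f g) = Add A (Fmor G f) (Fmor G g)"
  using assms by (simp_all add: pullback_addition_def)

lemma pullback_Zero [simp]:
  assumes "X \<in> Ob D" "Y \<in> Ob D"
  shows "Zero pullback_addition X Y \<in> Mor D" "Src D (Zero pullback_addition X Y) = X"
    "Tgt D (Zero pullback_addition X Y) = Y"
    "Fmor G (Zero pullback_addition X Y) = Zero A (Fob G X) (Fob G Y)"
  using assms by (simp_all add: pullback_addition_def)

text \<open>Each axiom is an equation between parallel morphisms, so by faithfulness it may be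
  checked after applying \<open>G\<close>, where it is the same axiom in \<open>C\<close>. Only the
  additive inverse needs a witness, the lift of the inverse in \<open>C\<close>.\<close>

lemma pullback_preadditive: "preadditive_category D pullback_addition"
proof (intro preadditive_category.intro preadditive_category_axioms.intro dom.category_axioms)
  fix X Y assume [simp]: "X \<in> Ob D" "Y \<in> Ob D"
  show "comm_group (Hom_group D pullback_addition X Y)"
  proof (rule comm_groupI)
    fix f assume "f \<in> carrier (Hom_group D pullback_addition X Y)"
    then have [simp]: "f \<in> Mor D" "Src D f = X" "Tgt D f = Y"
      by (simp_all add: Hom_group_def Hom_def)
    let ?g = "lift_mor X Y (Neg C A (Fmor G f))"
    have "Add pullback_addition ?g f = Zero pullback_addition X Y"
    proof (rule faithful)
      show "Fmor G (Add pullback_addition ?g f) = Fmor G (Zero pullback_addition X Y)"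
        using cod.Neg_arrow(4)[of "Fmor G f"]
        by (simp add: cod.Add_commute[of "Neg C A (Fmor G f)"] del: cod.Neg_arrow(4))
    qed simp_all
    then show "\<exists>g\<in>carrier (Hom_group D pullback_addition X Y).
        monoid.mult (Hom_group D pullback_addition X Y) g f = one (Hom_group D pullback_addition X Y)"
      by (intro bexI[of _ ?g]) (simp_all add: Hom_group_def Hom_def)
  qed (auto simp: Hom_group_def Hom_def cod.Add_assoc' intro!: faithful, rule cod.Add_commute, simp_all)
next
  fix X Y Z f g h assume "f \<in> Hom D X Y" "g \<in> Hom D Y Z" "h \<in> Hom D Y Z"
  then show "Add pullback_addition g h \<cdot>\<^bsub>D\<^esub> f
      = Add pullback_addition (g \<cdot>\<^bsub>D\<^esub> f) (h \<cdot>\<^bsub>D\<^esub> f)"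
    by (intro faithful) (auto simp: Hom_def)
next
  fix X Y Z f g h assume "f \<in> Hom D X Y" "g \<in> Hom D X Y" "h \<in> Hom D Y Z"
  then show "h \<cdot>\<^bsub>D\<^esub> Add pullback_addition f g
      = Add pullback_addition (h \<cdot>\<^bsub>D\<^esub> f) (h \<cdot>\<^bsub>D\<^esub> g)"
    by (intro faithful) (auto simp: Hom_def)
qed

lemma pullback_additive: "additive_category D pullback_addition"
proof -
  interpret P: preadditive_category D pullback_addition by (rule pullback_preadditive)
  show ?thesis
  proof (intro additive_category.intro additive_category_axioms.intro dom.category_axioms)
    show "\<exists>Z. zero_object D Z"
    proof -
      obtain z where z: "zero_object C z" using cod.ex_zero_object by blast
      then obtain Y u where Y: "Y \<in> Ob D" "isomorphism_in C u" "Src C u = Fob G Y" "Tgt C u = z"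
        using ess_surj zero_object_def by metis
      obtain v where v: "u \<in> Mor C" "v \<in> Mor C" "Src C v = Tgt C u" "Tgt C v = Src C u"
        "v \<cdot>\<^bsub>C\<^esub> u = Idn C (Src C u)"
        using Y(2) by (rule cod.isoE)
      \<comment> \<open>The isomorphism \<open>u\<close> ends in the zero object \<open>z\<close>,
        hence is zero, and so is the identity \<open>v \<cdot> u\<close>.\<close>
      have "Idn C (Fob G Y) = Zero A (Fob G Y) (Fob G Y)"
        using v Y cod.into_zero_object[OF z v(1)] by simp
      then have "Idn D Y = Zero pullback_addition Y Y"
        by (intro faithful) (use Y in simp_all)
      then show ?thesis using Y P.zero_object_iff by blast
    qed
  next
    fix X Y assume XY [simp]: "X \<in> Ob D" "Y \<in> Ob D"
    obtain B where "is_biproduct C A (Fob G X) (Fob G Y) B"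
      using cod.ex_biproduct[of "Fob G X" "Fob G Y"] by auto
    note B [simp] = cod.is_biproduct_arrow[OF this]
    obtain P u where P: "P \<in> Ob D" "isomorphism_in C u" "Src C u = Fob G P" "Tgt C u = Bob B"
      using ess_surj[OF B(1)] by blast
    obtain v where v: "u \<in> Mor C" "v \<in> Mor C" "Src C v = Tgt C u" "Tgt C v = Src C u"
      "v \<cdot>\<^bsub>C\<^esub> u = Idn C (Src C u)" "u \<cdot>\<^bsub>C\<^esub> v = Idn C (Tgt C u)"
      using P(2) by (rule cod.isoE)
    note [simp] = P v
    have [simp]: "u \<cdot>\<^bsub>C\<^esub> v \<cdot>\<^bsub>C\<^esub> x = x" if "x \<in> Mor C" "Tgt C x = Bob B" for x
      by (rule cod.Cmp_cancel[OF v(6)]) (use that in simp_all)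
    have *: "Add A (v \<cdot>\<^bsub>C\<^esub> In1 B \<cdot>\<^bsub>C\<^esub> Pr1 B \<cdot>\<^bsub>C\<^esub> u) (v \<cdot>\<^bsub>C\<^esub> In2 B \<cdot>\<^bsub>C\<^esub> Pr2 B \<cdot>\<^bsub>C\<^esub> u)
       = Idn C (Fob G P)"
    proof -
      \<comment> \<open>The sum is the decomposition of the identity of \<open>Bob B\<close>,
        conjugated by \<open>u\<close> and \<open>v\<close>. The rule that folds this decomposition
        is switched off so that distributivity can act first.\<close>
      have "Add A (v \<cdot>\<^bsub>C\<^esub> In1 B \<cdot>\<^bsub>C\<^esub> Pr1 B \<cdot>\<^bsub>C\<^esub> u) (v \<cdot>\<^bsub>C\<^esub> In2 B \<cdot>\<^bsub>C\<^esub> Pr2 B \<cdot>\<^bsub>C\<^esub> u)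
        = v \<cdot>\<^bsub>C\<^esub> Add A (In1 B \<cdot>\<^bsub>C\<^esub> Pr1 B) (In2 B \<cdot>\<^bsub>C\<^esub> Pr2 B) \<cdot>\<^bsub>C\<^esub> u"
        by (simp del: B(20))
      then show ?thesis by simp
    qed
    \<comment> \<open>The biproduct in \<open>C\<close> is carried along \<open>u\<close> to the
      object \<open>G P\<close>, and its structure maps are then lifted to \<open>D\<close>.\<close>
    let ?B = "\<lparr>Bob = P, In1 = lift_mor X P (v \<cdot>\<^bsub>C\<^esub> In1 B), In2 = lift_mor Y P (v \<cdot>\<^bsub>C\<^esub> In2 B),
      Pr1 = lift_mor P X (Pr1 B \<cdot>\<^bsub>C\<^esub> u), Pr2 = lift_mor P Y (Pr2 B \<cdot>\<^bsub>C\<^esub> u)\<rparr>"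
    \<comment> \<open>Typing conditions are settled by rewriting; the five equations are compared
      under \<open>G\<close>.\<close>
    have "is_biproduct D pullback_addition X Y ?B"
      by (rule dom.is_biproductI; (simp; fail)?; rule faithful) (simp_all add: *)
    then show "\<exists>B. is_biproduct D pullback_addition X Y B" ..
  qed (fact P.Hom_group P.distrib_left P.distrib_right)+
qed

end

text \<open>Here \<open>A'\<close> is any additive structure on \<open>D\<close>, with no assumed
  relation to \<open>A\<close>; compatibility of \<open>G\<close> with the two additions is a
  result.\<close>

locale ff_ess_surj_additive2 = ff_ess_surj D C G + dom: additive_category D A' + cod: additive_category C A
  for D :: "('p, 'q) cat" and C :: "('o, 'm) cat" and G :: "('p, 'q, 'o, 'm) cat_functor"
    and A' :: "('p, 'q) hom_addition" and A :: "('o, 'm) hom_addition"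
begin

sublocale ff_ess_surj_additive D C G A ..

text \<open>The zero endomorphism of \<open>G Z\<close> lifts to an endomorphism of
  \<open>Z\<close>, which can only be the identity. Fullness takes the place of additivity, which is
  not yet available.\<close>

lemma G_zero_object:
  assumes "zero_object D Z"
  shows "zero_object C (Fob G Z)"
proof -
  have [simp]: "Z \<in> Ob D" using assms by (simp add: zero_object_def)
  define h where "h = lift_mor Z Z (Zero A (Fob G Z) (Fob G Z))"
  have h: "h \<in> Mor D" "Src D h = Z" "Tgt D h = Z" "Fmor G h = Zero A (Fob G Z) (Fob G Z)"
    by (simp_all add: h_def)
  have "h = Idn D Z"
    using dom.into_zero_object[OF assms h(1,3)] assms h(2) by (simp add: dom.zero_object_iff)
  then show ?thesis using h(4) by (simp add: cod.zero_object_iff)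
qed

text \<open>A zero morphism factors through a zero object, and zero objects are already known to be
  preserved.\<close>

lemma G_Zero [simp]:
  assumes [simp]: "X \<in> Ob D" "Y \<in> Ob D"
  shows "Fmor G (Zero A' X Y) = Zero A (Fob G X) (Fob G Y)"
proof -
  obtain Z where Z: "zero_object D Z" using dom.ex_zero_object by blast
  then have [simp]: "Z \<in> Ob D" by (simp add: zero_object_def)
  have "Fmor G (Zero A' X Y) = Fmor G (Zero A' Z Y) \<cdot>\<^bsub>C\<^esub> Fmor G (Zero A' X Z)"
    using functor_arrow(6)[OF G, of "Zero A' X Z" "Zero A' Z Y"] by simp
  also have "Fmor G (Zero A' X Z) = Zero A (Fob G X) (Fob G Z)"
    using cod.into_zero_object[OF G_zero_object[OF Z], of "Fmor G (Zero A' X Z)"] by simp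
  finally show ?thesis by simp
qed

text \<open>The proof of additivity rests on this, so no sum may be moved through \<open>G\<close>.
  Four of the equations are images of equations without sums. The fifth contains a sum formed in
  \<open>C\<close>; its left-hand side \<open>e\<close> is lifted to \<open>D\<close> and compared
  there with the identity, using that the projections of \<open>B\<close> are jointly monic.\<close>

lemma G_biproduct:
  assumes "is_biproduct D A' X Y B"
  shows "is_biproduct C A (Fob G X) (Fob G Y) (map_biproduct G B)"
proof -
  note B [simp] = dom.is_biproduct_arrow[OF assms]
  note G_Cmp = functor_arrow(6)[OF G]
  have eqs [simp]:
    "Fmor G (Pr1 B) \<cdot>\<^bsub>C\<^esub> Fmor G (In1 B) = Idn C (Fob G X)"
    "Fmor G (Pr2 B) \<cdot>\<^bsub>C\<^esub> Fmor G (In2 B) = Idn C (Fob G Y)"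
    "Fmor G (Pr1 B) \<cdot>\<^bsub>C\<^esub> Fmor G (In2 B) = Zero A (Fob G Y) (Fob G X)"
    "Fmor G (Pr2 B) \<cdot>\<^bsub>C\<^esub> Fmor G (In1 B) = Zero A (Fob G X) (Fob G Y)"
    using G_Cmp[of "In1 B" "Pr1 B"] G_Cmp[of "In2 B" "Pr2 B"]
      G_Cmp[of "In2 B" "Pr1 B"] G_Cmp[of "In1 B" "Pr2 B"] by simp_all
  have monic: "a = b" if "a \<in> Mor D" "b \<in> Mor D" "Src D a = W" "Src D b = W"
    "Tgt D a = Bob B" "Tgt D b = Bob B" "Pr1 B \<cdot>\<^bsub>D\<^esub> a = Pr1 B \<cdot>\<^bsub>D\<^esub> b"
    "Pr2 B \<cdot>\<^bsub>D\<^esub> a = Pr2 B \<cdot>\<^bsub>D\<^esub> b" for a b W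
  proof -
    have "x = Add A' (In1 B \<cdot>\<^bsub>D\<^esub> Pr1 B \<cdot>\<^bsub>D\<^esub> x) (In2 B \<cdot>\<^bsub>D\<^esub> Pr2 B \<cdot>\<^bsub>D\<^esub> x)"
      if "x \<in> Mor D" "Tgt D x = Bob B" for x
    proof -
      have "x = Add A' (In1 B \<cdot>\<^bsub>D\<^esub> Pr1 B) (In2 B \<cdot>\<^bsub>D\<^esub> Pr2 B) \<cdot>\<^bsub>D\<^esub> x"
        using that by simp
      then show ?thesis using that by (simp del: B(20))
    qed
    then show ?thesis using that by metis
  qed
  define e where "e = Add A (Fmor G (In1 B) \<cdot>\<^bsub>C\<^esub> Fmor G (Pr1 B)) (Fmor G (In2 B) \<cdot>\<^bsub>C\<^esub> Fmor G (Pr2 B))"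
  have e: "e \<in> Mor C" "Src C e = Fob G (Bob B)" "Tgt C e = Fob G (Bob B)"
    by (simp_all add: e_def)
  have cancel: "Fmor G (Pr1 B) \<cdot>\<^bsub>C\<^esub> Fmor G (In1 B) \<cdot>\<^bsub>C\<^esub> x = x"
    "Fmor G (Pr2 B) \<cdot>\<^bsub>C\<^esub> Fmor G (In1 B) \<cdot>\<^bsub>C\<^esub> x = Zero A (Src C x) (Fob G Y)"
    if "x \<in> Mor C" "Tgt C x = Fob G X" for x
    using that cod.Cmp_arrow_assoc[of x "Fmor G (In1 B)" "Fmor G (Pr1 B)"]
      cod.Cmp_arrow_assoc[of x "Fmor G (In1 B)" "Fmor G (Pr2 B)"] by simp_all
  have cancel': "Fmor G (Pr1 B) \<cdot>\<^bsub>C\<^esub> Fmor G (In2 B) \<cdot>\<^bsub>C\<^esub> x = Zero A (Src C x) (Fob G X)"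
    "Fmor G (Pr2 B) \<cdot>\<^bsub>C\<^esub> Fmor G (In2 B) \<cdot>\<^bsub>C\<^esub> x = x"
    if "x \<in> Mor C" "Tgt C x = Fob G Y" for x
    using that cod.Cmp_arrow_assoc[of x "Fmor G (In2 B)" "Fmor G (Pr1 B)"]
      cod.Cmp_arrow_assoc[of x "Fmor G (In2 B)" "Fmor G (Pr2 B)"] by simp_all
  define d where "d = lift_mor (Bob B) (Bob B) e"
  have d: "d \<in> Mor D" "Src D d = Bob B" "Tgt D d = Bob B" "Fmor G d = e"
    using e by (simp_all add: d_def)
  have "d = Idn D (Bob B)"
  proof (rule monic[of _ _ "Bob B"])
    show "Pr1 B \<cdot>\<^bsub>D\<^esub> d = Pr1 B \<cdot>\<^bsub>D\<^esub> Idn D (Bob B)"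
      by (rule faithful) (use d in \<open>simp_all add: e_def cancel cancel'\<close>)
    show "Pr2 B \<cdot>\<^bsub>D\<^esub> d = Pr2 B \<cdot>\<^bsub>D\<^esub> Idn D (Bob B)"
      by (rule faithful) (use d in \<open>simp_all add: e_def cancel cancel'\<close>)
  qed (use d in simp_all)
  then have "e = Idn C (Fob G (Bob B))" using d by simp
  then show ?thesis
    unfolding e_def by (intro cod.is_biproductI) (simp_all add: map_biproduct_def)
qed

text \<open>An equivalence preserves sums because \<open>f + g\<close> is the composite of the morphism
  \<open>(f, g)\<close> into a biproduct with the codiagonal.\<close>

lemma G_Add [simp]:
  assumes [simp]: "f \<in> Mor D" "g \<in> Mor D" "Src D f = Src D g" "Tgt D f = Tgt D g"
  shows "Fmor G (Add A' f g) = Add A (Fmor G f) (Fmor G g)"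
proof -
  define Y where "Y = Tgt D g"
  have Y [simp]: "Y \<in> Ob D" "Tgt D g = Y" by (simp_all add: Y_def)
  obtain B where bip: "is_biproduct D A' Y Y B" using dom.ex_biproduct[of Y Y] by auto
  note B [simp] = dom.is_biproduct_arrow[OF bip]
  note GB = cod.is_biproduct_arrow[OF G_biproduct[OF bip], unfolded map_biproduct_def, simplified]
  note G_Cmp = functor_arrow(6)[OF G]
  define s where "s = Add A' (Pr1 B) (Pr2 B)"
  define t where "t = Add A' (In1 B \<cdot>\<^bsub>D\<^esub> f) (In2 B \<cdot>\<^bsub>D\<^esub> g)"
  have s: "s \<in> Mor D" "Src D s = Bob B" "Tgt D s = Y" "s \<cdot>\<^bsub>D\<^esub> In1 B = Idn D Y" "s \<cdot>\<^bsub>D\<^esub> In2 B = Idn D Y"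
    by (simp_all add: s_def)
  have dcancel: "Pr1 B \<cdot>\<^bsub>D\<^esub> In1 B \<cdot>\<^bsub>D\<^esub> x = x" "Pr2 B \<cdot>\<^bsub>D\<^esub> In1 B \<cdot>\<^bsub>D\<^esub> x = Zero A' (Src D x) Y"
    "Pr1 B \<cdot>\<^bsub>D\<^esub> In2 B \<cdot>\<^bsub>D\<^esub> x = Zero A' (Src D x) Y" "Pr2 B \<cdot>\<^bsub>D\<^esub> In2 B \<cdot>\<^bsub>D\<^esub> x = x"
    if "x \<in> Mor D" "Tgt D x = Y" for x
    using that dom.Cmp_arrow_assoc[of x "In1 B" "Pr1 B"] dom.Cmp_arrow_assoc[of x "In1 B" "Pr2 B"]
      dom.Cmp_arrow_assoc[of x "In2 B" "Pr1 B"] dom.Cmp_arrow_assoc[of x "In2 B" "Pr2 B"] by simp_all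
  have t: "t \<in> Mor D" "Src D t = Src D g" "Tgt D t = Bob B" "Pr1 B \<cdot>\<^bsub>D\<^esub> t = f" "Pr2 B \<cdot>\<^bsub>D\<^esub> t = g"
    by (simp_all add: t_def dcancel)
  have "s \<cdot>\<^bsub>D\<^esub> t = Add A' f g"
    using t by (simp add: s_def)
  then have "Fmor G (Add A' f g) = Fmor G s \<cdot>\<^bsub>C\<^esub> Fmor G t"
    using G_Cmp[of t s] s t by simp
  \<comment> \<open>Here the addition of \<open>C\<close> enters: the identity of
    \<open>G (Bob B)\<close> is a sum because \<open>G\<close> preserves the biproduct. The
    remaining facts about \<open>G s\<close> and \<open>G t\<close> are images of equations between
    composites, which any functor preserves.\<close>
  also have "Fmor G t = Idn C (Fob G (Bob B)) \<cdot>\<^bsub>C\<^esub> Fmor G t" using t by simp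
  also have "\<dots> = Add A (Fmor G (In1 B) \<cdot>\<^bsub>C\<^esub> Fmor G (Pr1 B) \<cdot>\<^bsub>C\<^esub> Fmor G t)
      (Fmor G (In2 B) \<cdot>\<^bsub>C\<^esub> Fmor G (Pr2 B) \<cdot>\<^bsub>C\<^esub> Fmor G t)"
    unfolding GB(20)[symmetric] using t(1-3) by (simp del: GB)
  also have "\<dots> = Add A (Fmor G (In1 B) \<cdot>\<^bsub>C\<^esub> Fmor G f) (Fmor G (In2 B) \<cdot>\<^bsub>C\<^esub> Fmor G g)"
    using G_Cmp[of t "Pr1 B"] G_Cmp[of t "Pr2 B"] t by simp
  also have "Fmor G s \<cdot>\<^bsub>C\<^esub> \<dots> = Add A ((Fmor G s \<cdot>\<^bsub>C\<^esub> Fmor G (In1 B)) \<cdot>\<^bsub>C\<^esub> Fmor G f)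
      ((Fmor G s \<cdot>\<^bsub>C\<^esub> Fmor G (In2 B)) \<cdot>\<^bsub>C\<^esub> Fmor G g)"
    using s(1-3) by simp
  also have "\<dots> = Add A (Fmor G f) (Fmor G g)"
  proof -
    have "Fmor G s \<cdot>\<^bsub>C\<^esub> Fmor G (In1 B) = Idn C (Fob G Y)" "Fmor G s \<cdot>\<^bsub>C\<^esub> Fmor G (In2 B) = Idn C (Fob G Y)"
      using G_Cmp[of "In1 B" s] G_Cmp[of "In2 B" s] s by simp_all
    then show ?thesis by simp
  qed
  finally show ?thesis .
qed

lemma G_Neg [simp]:
  assumes [simp]: "f \<in> Mor D"
  shows "Fmor G (Neg D A' f) = Neg C A (Fmor G f)"
proof (rule cod.Neg_unique)
  have "Add A (Fmor G f) (Fmor G (Neg D A' f)) = Fmor G (Add A' f (Neg D A' f))"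
    by (subst G_Add) simp_all
  then show "Add A (Fmor G f) (Fmor G (Neg D A' f)) = Zero A (Src C (Fmor G f)) (Tgt C (Fmor G f))"
    by simp
qed simp_all

lemma G_additive: "additive_functor D A' C A G"
  using G by (auto simp: additive_functor_def Hom_def)

end

section \<open>Sequences\<close>

lemma sigma_seqI:
  assumes "length X = n + 2" "\<And>i. i \<le> Suc n \<Longrightarrow> X ! i \<in> Mor C"
    "\<And>i. i \<le> n \<Longrightarrow> Tgt C (X ! i) = Src C (X ! Suc i)"
    "Tgt C (X ! Suc n) = Fob S (Src C (X ! 0))"
  shows "sigma_seq C n S X"
  using assms unfolding sigma_seq_def by (auto simp: in_set_conv_nth)

lemma sigma_seqD:
  assumes "sigma_seq C n S X"
  shows "length X = Suc (Suc n)" "i \<le> Suc n \<Longrightarrow> X ! i \<in> Mor C"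
    "i \<le> n \<Longrightarrow> Tgt C (X ! i) = Src C (X ! Suc i)"
    "Tgt C (X ! Suc n) = Fob S (Src C (X ! 0))"
  using assms nth_mem[of i X] unfolding sigma_seq_def by auto

lemma seq_morI:
  assumes "length f = n + 2"
    "\<And>i. i \<le> Suc n \<Longrightarrow> f ! i \<in> Mor C" "\<And>i. i \<le> Suc n \<Longrightarrow> Src C (f ! i) = Src C (X ! i)"
    "\<And>i. i \<le> Suc n \<Longrightarrow> Tgt C (f ! i) = Src C (Y ! i)"
    "\<And>i. i \<le> n \<Longrightarrow> f ! Suc i \<cdot>\<^bsub>C\<^esub> X ! i = Y ! i \<cdot>\<^bsub>C\<^esub> f ! i"
    "Fmor S (f ! 0) \<cdot>\<^bsub>C\<^esub> X ! Suc n = Y ! Suc n \<cdot>\<^bsub>C\<^esub> f ! Suc n"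
  shows "seq_mor C n S X Y f"
  using assms unfolding seq_mor_def Hom_def by auto

lemma seq_morD:
  assumes "seq_mor C n S X Y f"
  shows "length f = Suc (Suc n)"
    "i \<le> Suc n \<Longrightarrow> f ! i \<in> Mor C" "i \<le> Suc n \<Longrightarrow> Src C (f ! i) = Src C (X ! i)"
    "i \<le> Suc n \<Longrightarrow> Tgt C (f ! i) = Src C (Y ! i)"
    "i \<le> n \<Longrightarrow> f ! Suc i \<cdot>\<^bsub>C\<^esub> X ! i = Y ! i \<cdot>\<^bsub>C\<^esub> f ! i"
    "Fmor S (f ! 0) \<cdot>\<^bsub>C\<^esub> X ! Suc n = Y ! Suc n \<cdot>\<^bsub>C\<^esub> f ! Suc n"
  using assms unfolding seq_mor_def Hom_def by auto

lemma nth_map_upt_Suc_Suc [simp]: "i \<le> Suc n \<Longrightarrow> map f [0..<Suc (Suc n)] ! i = f i"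
  by (simp del: upt_Suc)

section \<open>Isomorphisms of sequences and invariance of angles\<close>

lemma (in category) inverse_square:
  assumes "b \<cdot> x = y \<cdot> a"
    and "a \<in> Mor C" "a' \<in> Mor C" "Src C a' = Tgt C a" "Tgt C a' = Src C a" "a \<cdot> a' = Idn C (Tgt C a)"
    and "b \<in> Mor C" "b' \<in> Mor C" "Src C b' = Tgt C b" "Tgt C b' = Src C b" "b' \<cdot> b = Idn C (Src C b)"
    and "x \<in> Mor C" "y \<in> Mor C" "Src C x = Src C a" "Tgt C x = Src C b" "Src C y = Tgt C a" "Tgt C y = Tgt C b"
  shows "b' \<cdot> y = x \<cdot> a'"
proof -
  have "b' \<cdot> y = b' \<cdot> (y \<cdot> a) \<cdot> a'"
    using assms by simp
  also have "\<dots> = b' \<cdot> (b \<cdot> x) \<cdot> a'" using assms(1) by simp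
  also have "\<dots> = b' \<cdot> b \<cdot> x \<cdot> a'" using assms(2-) by simp
  also have "\<dots> = x \<cdot> a'" by (rule Cmp_cancel) (use assms in simp_all)
  finally show ?thesis .
qed

lemma (in category) seq_iso_inverse:
  assumes "is_functor C C S" and X: "sigma_seq C n S X" and Y: "sigma_seq C n S Y"
    and f: "seq_mor C n S X Y f" and iso: "\<And>k. k \<le> Suc n \<Longrightarrow> isomorphism_in C (f ! k)"
  obtains g where "seq_mor C n S Y X g"
    "\<And>k. k \<le> Suc n \<Longrightarrow> g ! k \<cdot> f ! k = Idn C (Src C (X ! k))"
    "\<And>k. k \<le> Suc n \<Longrightarrow> f ! k \<cdot> g ! k = Idn C (Src C (Y ! k))"
proof -
  note [simp] = sigma_seqD[OF X] sigma_seqD[OF Y] seq_morD(1-4)[OF f]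
    functor_arrow(1-5)[OF assms(1)] Src_Ob Tgt_Ob
  have "\<exists>v. v \<in> Mor C \<and> Src C v = Src C (Y ! k) \<and> Tgt C v = Src C (X ! k) \<and>
      v \<cdot> f ! k = Idn C (Src C (X ! k)) \<and> f ! k \<cdot> v = Idn C (Src C (Y ! k))" if "k \<le> Suc n" for k
    by (rule isoE[OF iso[OF that]]) (use that in auto)
  then obtain v where v: "v k \<in> Mor C" "Src C (v k) = Src C (Y ! k)" "Tgt C (v k) = Src C (X ! k)"
      "v k \<cdot> f ! k = Idn C (Src C (X ! k))" "f ! k \<cdot> v k = Idn C (Src C (Y ! k))"
    if "k \<le> Suc n" for k by metis
  have "seq_mor C n S Y X (map v [0..<Suc (Suc n)])"
  proof (rule seq_morI)
    fix i assume i: "i \<le> n"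
    have "v (Suc i) \<cdot> Y ! i = X ! i \<cdot> v i"
      by (rule inverse_square[OF seq_morD(5)[OF f i]]) (use i v[of i] v[of "Suc i"] in simp_all)
    then show "map v [0..<Suc (Suc n)] ! Suc i \<cdot> Y ! i = X ! i \<cdot> map v [0..<Suc (Suc n)] ! i"
      using i by (simp del: upt_Suc)
  next
    \<comment> \<open>The closing square has \<open>S (f ! 0)\<close> on one side, so its inverse
      must be known to be \<open>S (v 0)\<close>.\<close>
    have "Fmor S (v 0) \<cdot> Fmor S (f ! 0) = Idn C (Fob S (Src C (X ! 0)))"
      using functor_arrow(6)[OF assms(1), of "f ! 0" "v 0"] v[of 0] by simp
    then have "Fmor S (v 0) \<cdot> Y ! Suc n = X ! Suc n \<cdot> v (Suc n)"
      by (intro inverse_square[OF seq_morD(6)[OF f]]) (use v[of 0] v[of "Suc n"] in simp_all)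
    then show "Fmor S (map v [0..<Suc (Suc n)] ! 0) \<cdot> Y ! Suc n
        = X ! Suc n \<cdot> map v [0..<Suc (Suc n)] ! Suc n"
      by (simp del: upt_Suc)
  qed (simp_all del: upt_Suc add: v)
  then show ?thesis
    by (rule that) (use v in \<open>simp_all del: upt_Suc\<close>)
qed

text \<open>\<open>Y\<close> is a direct sum of \<open>X\<close> and a sequence of zero objects.\<close>

lemma (in weak_pre_angulated_category) T_iso_aux:
  assumes X: "X \<in> T" and Y: "sigma_seq C n S Y"
    and f: "seq_mor C n S X Y f" and g: "seq_mor C n S Y X g"
    and gf: "\<And>k. k \<le> Suc n \<Longrightarrow> g ! k \<cdot> f ! k = Idn C (Src C (X ! k))"
    and fg: "\<And>k. k \<le> Suc n \<Longrightarrow> f ! k \<cdot> g ! k = Idn C (Src C (Y ! k))"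
  shows "Y \<in> T"
proof -
  note X' = T_sigma_seq[OF X]
  \<comment> \<open>As an equivalence, \<open>S\<close> preserves zero morphisms; the closing
    squares of \<open>i2\<close> and \<open>p2\<close> depend on it.\<close>
  interpret S: ff_ess_surj_additive2 C C S A A
    by (intro ff_ess_surj_additive2.intro additive_category_axioms
        is_equivalence_imp_ff_ess_surj category_axioms autoequivalence_S)
  note [simp] = sigma_seqD[OF X'] sigma_seqD[OF Y] seq_morD(1-4)[OF f] seq_morD(1-4)[OF g] gf fg
  obtain z where z: "zero_object C z" using ex_zero_object by blast
  then have Idn_z: "z \<in> Ob C" "Idn C z = Zero A z z" by (auto simp: zero_object_iff)
  have zS: "zero_object C (Fob S z)" by (rule S.G_zero_object[OF z])
  note [simp] = Idn_z
  have [simp]: "Fob S z \<in> Ob C" by simp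
  \<comment> \<open>All objects are \<open>z\<close>, but the last morphism must end in
    \<open>S z\<close>, which may differ from \<open>z\<close>.\<close>
  define E where "E = map (\<lambda>k. Zero A z (if k \<le> n then z else Fob S z)) [0..<Suc (Suc n)]"
  have E: "length E = Suc (Suc n)" "i \<le> n \<Longrightarrow> E ! i = Zero A z z" "E ! Suc n = Zero A z (Fob S z)" for i
    by (simp_all add: E_def del: upt_Suc)
  have SrcE: "Src C (E ! i) = z" if "i \<le> Suc n" for i
    using that by (simp add: E_def del: upt_Suc)
  have sE: "sigma_seq C n S E"
  proof (rule sigma_seqI)
    fix i assume "i \<le> Suc n"
    then show "E ! i \<in> Mor C" by (simp add: E_def del: upt_Suc)
  qed (simp_all add: E SrcE)
  have ET: "E \<in> T"
    by (rule F1_zero[OF sE]) (use z in \<open>simp add: SrcE\<close>)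
  define i2 where "i2 = map (\<lambda>k. Zero A z (Src C (Y ! k))) [0..<Suc (Suc n)]"
  define p2 where "p2 = map (\<lambda>k. Zero A (Src C (Y ! k)) z) [0..<Suc (Suc n)]"
  have i2: "length i2 = Suc (Suc n)" "k \<le> Suc n \<Longrightarrow> i2 ! k = Zero A z (Src C (Y ! k))" for k
    by (simp_all add: i2_def del: upt_Suc)
  have p2: "length p2 = Suc (Suc n)" "k \<le> Suc n \<Longrightarrow> p2 ! k = Zero A (Src C (Y ! k)) z" for k
    by (simp_all add: p2_def del: upt_Suc)
  have "seq_mor C n S E Y i2"
    by (rule seq_morI) (simp_all add: i2 E SrcE)
  moreover have "seq_mor C n S Y E p2"
    by (rule seq_morI) (simp_all add: p2 E SrcE)
  moreover have "is_biproduct C A (Src C (X ! k)) (Src C (E ! k))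
      \<lparr>Bob = Src C (Y ! k), In1 = f ! k, In2 = i2 ! k, Pr1 = g ! k, Pr2 = p2 ! k\<rparr>"
    if "k \<le> n + 1" for k
    by (rule is_biproductI) (use that in \<open>simp_all add: SrcE i2 p2\<close>)
  ultimately have "seq_direct_sum C A n S X E Y"
    using X' Y sE f g unfolding seq_direct_sum_def by blast
  then show ?thesis using F1_sum X ET by blast
qed

text \<open>Rotation, completion of a prescribed first morphism and the passage along the unit
  reproduce a sequence only up to isomorphism; this is what makes them usable for membership in
  \<open>T\<close>.\<close>

lemma (in weak_pre_angulated_category) T_iso:
  assumes X: "sigma_seq C n S X" and Y: "sigma_seq C n S Y"
    and f: "seq_mor C n S X Y f" and iso: "\<And>k. k \<le> Suc n \<Longrightarrow> isomorphism_in C (f ! k)"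
  shows "X \<in> T \<longleftrightarrow> Y \<in> T"
proof -
  have S: "is_functor C C S" using autoequivalence_S by (simp add: is_equivalence_def)
  obtain g where g: "seq_mor C n S Y X g"
    "\<And>k. k \<le> Suc n \<Longrightarrow> g ! k \<cdot> f ! k = Idn C (Src C (X ! k))"
    "\<And>k. k \<le> Suc n \<Longrightarrow> f ! k \<cdot> g ! k = Idn C (Src C (Y ! k))"
    using seq_iso_inverse[OF S X Y f iso] by blast
  show ?thesis
    using T_iso_aux[OF _ Y f g(1-3)] T_iso_aux[OF _ X g(1) f g(3,2)] by blast
qed

text \<open>The sequence occurring in \<open>angulated_functor\<close>. It is named because it
  serves twice: for \<open>F\<close> with \<open>\<Theta>\<close>, and for the quasi-inverse
  \<open>G\<close> with \<open>\<Phi>\<close>.\<close>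

definition map_seq ::
  "('o, 'm) cat \<Rightarrow> ('p, 'q) cat \<Rightarrow> ('o, 'm, 'p, 'q) cat_functor \<Rightarrow> ('o \<Rightarrow> 'q) \<Rightarrow> 'm list \<Rightarrow> 'q list" where
  "map_seq C D F \<Theta> X = map (Fmor F) (butlast X) @ [\<Theta> (Src C (X ! 0)) \<cdot>\<^bsub>D\<^esub> Fmor F (last X)]"

lemma map_seq_nth [simp]:
  assumes "length X = Suc (Suc n)"
  shows "length (map_seq C D F \<Theta> X) = Suc (Suc n)"
    "i \<le> n \<Longrightarrow> map_seq C D F \<Theta> X ! i = Fmor F (X ! i)"
    "map_seq C D F \<Theta> X ! Suc n = \<Theta> (Src C (X ! 0)) \<cdot>\<^bsub>D\<^esub> Fmor F (X ! Suc n)"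
proof -
  have "X \<noteq> []" using assms by auto
  then show "length (map_seq C D F \<Theta> X) = Suc (Suc n)"
    "i \<le> n \<Longrightarrow> map_seq C D F \<Theta> X ! i = Fmor F (X ! i)"
    "map_seq C D F \<Theta> X ! Suc n = \<Theta> (Src C (X ! 0)) \<cdot>\<^bsub>D\<^esub> Fmor F (X ! Suc n)"
    using assms last_conv_nth[of X] by (auto simp: map_seq_def nth_append nth_butlast)
qed

lemma map_seq_arrow:
  assumes "category C" "category D" "is_functor C D F" "is_functor C C S" "is_functor D D S'"
    and \<Theta>: "natural_iso C D (comp_functor F S) (comp_functor S' F) \<Theta>" and X: "sigma_seq C n S X"
  shows "i \<le> Suc n \<Longrightarrow> map_seq C D F \<Theta> X ! i \<in> Mor D"
    and "i \<le> Suc n \<Longrightarrow> Src D (map_seq C D F \<Theta> X ! i) = Fob F (Src C (X ! i))"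
    and "sigma_seq D n S' (map_seq C D F \<Theta> X)"
proof -
  interpret C: category C by fact
  interpret D: category D by fact
  note [simp] = sigma_seqD[OF X] functor_arrow[OF assms(3)] functor_arrow[OF assms(4)]
    functor_arrow[OF assms(5)] natural_iso_arrow(1-3)[OF \<Theta>] C.Src_Ob C.Tgt_Ob
  show 1: "map_seq C D F \<Theta> X ! i \<in> Mor D" if "i \<le> Suc n" for i
    using that by (cases "i = Suc n") simp_all
  show 2: "Src D (map_seq C D F \<Theta> X ! i) = Fob F (Src C (X ! i))" if "i \<le> Suc n" for i
    using that by (cases "i = Suc n") simp_all
  show "sigma_seq D n S' (map_seq C D F \<Theta> X)"
    by (rule sigma_seqI) (simp_all add: 1 2)
qed

text \<open>Subtraction is truncated: for \<open>n = 0\<close> the list would have three entries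
  instead of two.\<close>

lemma trivial_seq_nth:
  assumes "n \<ge> 1"
  shows "length (trivial_seq C A n S X Z) = Suc (Suc n)"
    "trivial_seq C A n S X Z ! 0 = Idn C X"
    "trivial_seq C A n S X Z ! Suc 0 = Zero A X Z"
    "\<lbrakk>Suc 0 < i; i \<le> n\<rbrakk> \<Longrightarrow> trivial_seq C A n S X Z ! i = Zero A Z Z"
    "trivial_seq C A n S X Z ! Suc n = Zero A Z (Fob S X)"
  using assms by (auto simp: trivial_seq_def nth_append nth_Cons split: nat.splits)

lemma rotation_nth:
  assumes "length X = Suc (Suc n)"
  shows "length (rotation C A n S X) = Suc (Suc n)"
    "i \<le> n \<Longrightarrow> rotation C A n S X ! i = X ! Suc i"
    "rotation C A n S X ! Suc n = (if even n then Fmor S (X ! 0) else Neg C A (Fmor S (X ! 0)))"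
  using assms by (simp_all add: rotation_def nth_append nth_tl)

text \<open>Position \<open>n + 1\<close> is exceptional. It reads the entries appended to
  \<open>X\<close> and \<open>f\<close>, which are images under \<open>S\<close>, and it ends in the
  image of \<open>B 0\<close> instead of in a further biproduct of the family.\<close>

lemma cone_nth:
  assumes "length X = Suc (Suc n)" "length f = Suc (Suc n)"
  shows "length (cone C A n S X Y f B) = Suc (Suc n)"
    "i \<le> n \<Longrightarrow> cone C A n S X Y f B ! i = matrix_mor C A (B i) (B (Suc i))
       (Neg C A (X ! Suc i)) (Zero A (Src C (Y ! i)) (Tgt C (X ! Suc i))) (f ! Suc i) (Y ! i)"
    "cone C A n S X Y f B ! Suc n = matrix_mor C A (B (Suc n)) (map_biproduct S (B 0))
       (Neg C A (Fmor S (X ! 0))) (Zero A (Src C (Y ! Suc n)) (Tgt C (Fmor S (X ! 0))))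
       (Fmor S (f ! 0)) (Y ! Suc n)"
  using assms by (simp_all add: cone_def Let_def nth_append del: upt_Suc)

lemma cone_biproductsD:
  assumes "cone_biproducts C A n S X Y B" "length X = Suc (Suc n)"
  shows "i \<le> n \<Longrightarrow> is_biproduct C A (Src C (X ! Suc i)) (Src C (Y ! i)) (B i)"
    "is_biproduct C A (Src C (Fmor S (X ! 0))) (Src C (Y ! Suc n)) (B (Suc n))"
proof -
  show "is_biproduct C A (Src C (X ! Suc i)) (Src C (Y ! i)) (B i)" if "i \<le> n"
    using assms that unfolding cone_biproducts_def by (auto simp: nth_append dest!: spec[of _ i])
  show "is_biproduct C A (Src C (Fmor S (X ! 0))) (Src C (Y ! Suc n)) (B (Suc n))"
    using assms unfolding cone_biproducts_def by (auto simp: nth_append dest!: spec[of _ "Suc n"])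
qed

lemma cone_biproductsI:
  assumes "\<And>i. i \<le> n \<Longrightarrow> is_biproduct C A (Src C (X ! Suc i)) (Src C (Y ! i)) (B i)"
    "is_biproduct C A (Src C (Fmor S (X ! 0))) (Src C (Y ! Suc n)) (B (Suc n))"
    "length X = Suc (Suc n)"
  shows "cone_biproducts C A n S X Y B"
  using assms unfolding cone_biproducts_def by (auto simp: nth_append le_Suc_eq)

lemma (in preadditive_category) matrix_mor_arrow [simp]:
  assumes "is_biproduct C A P Q B" "is_biproduct C A P' Q' B'"
    "a \<in> Mor C" "Src C a = P" "Tgt C a = P'" "b \<in> Mor C" "Src C b = Q" "Tgt C b = P'"
    "c \<in> Mor C" "Src C c = P" "Tgt C c = Q'" "d \<in> Mor C" "Src C d = Q" "Tgt C d = Q'"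
  shows "matrix_mor C A B B' a b c d \<in> Mor C" "Src C (matrix_mor C A B B' a b c d) = Bob B"
    "Tgt C (matrix_mor C A B B' a b c d) = Bob B'"
  using assms is_biproduct_arrow[OF assms(1)] is_biproduct_arrow[OF assms(2)]
  by (simp_all add: matrix_mor_def)

lemma (in additive_category) rotation_sigma_seq:
  assumes S: "is_functor C C S" and X: "sigma_seq C n S X"
  shows "sigma_seq C n S (rotation C A n S X)"
proof -
  note [simp] = sigma_seqD[OF X] rotation_nth[OF sigma_seqD(1)[OF X]] functor_arrow[OF S] Src_Ob Tgt_Ob
  show ?thesis
  proof (rule sigma_seqI)
    fix i
    show "rotation C A n S X ! i \<in> Mor C" if "i \<le> Suc n"
      using that by (cases "i = Suc n") simp_all
    show "Tgt C (rotation C A n S X ! i) = Src C (rotation C A n S X ! Suc i)" if "i \<le> n"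
      using that by (cases "i = n") simp_all
  qed simp_all
qed

section \<open>Pulling back angles along an equivalence\<close>

text \<open>The axioms are transferred using only that \<open>S'\<close> is an autoequivalence
  related to \<open>S\<close> by \<open>\<Phi>\<close>; the construction of \<open>S'\<close> from
  \<open>F\<close> stays hidden. The inverse \<open>\<Psi>\<close> is a parameter so that its
  cancellation laws can serve as rewrite rules.\<close>

locale angle_pullback = ff_ess_surj_additive2 D C G A' A + cod: weak_pre_angulated_category C A n S T
  for D :: "('p, 'q) cat" and C :: "('o, 'm) cat" and G :: "('p, 'q, 'o, 'm) cat_functor"
    and A' :: "('p, 'q) hom_addition" and A :: "('o, 'm) hom_addition"
    and n :: nat and S :: "('o, 'm, 'o, 'm) cat_functor" and T :: "'m list set" +
  fixes S' :: "('p, 'q, 'p, 'q) cat_functor" and \<Phi> \<Psi> :: "'p \<Rightarrow> 'm"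
  assumes autoequivalence_S': "autoequivalence D S'"
    and \<Phi>: "natural_iso D C (comp_functor G S') (comp_functor S G) \<Phi>"
    and \<Psi>: "X \<in> Ob D \<Longrightarrow> \<Psi> X \<in> Hom C (Fob S (Fob G X)) (Fob G (Fob S' X))"
    and \<Psi>_\<Phi>: "X \<in> Ob D \<Longrightarrow> \<Psi> X \<cdot>\<^bsub>C\<^esub> \<Phi> X = Idn C (Fob G (Fob S' X))"
    and \<Phi>_\<Psi>: "X \<in> Ob D \<Longrightarrow> \<Phi> X \<cdot>\<^bsub>C\<^esub> \<Psi> X = Idn C (Fob S (Fob G X))"
    and n_pos: "n \<ge> 1"
begin

lemma S: "is_functor C C S" and S': "is_functor D D S'"
  using cod.autoequivalence_S autoequivalence_S' by (simp_all add: is_equivalence_def)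

lemma n_neq_0 [simp]: "n \<noteq> 0"
  using n_pos by simp

lemmas S_arrow [simp] = functor_arrow[OF S] functor_arrow[OF S']

lemma \<Phi>_arrow [simp]:
  assumes "X \<in> Ob D"
  shows "\<Phi> X \<in> Mor C" "Src C (\<Phi> X) = Fob G (Fob S' X)" "Tgt C (\<Phi> X) = Fob S (Fob G X)"
    "\<Psi> X \<in> Mor C" "Src C (\<Psi> X) = Fob S (Fob G X)" "Tgt C (\<Psi> X) = Fob G (Fob S' X)"
  using natural_iso_arrow(1-3)[OF \<Phi> assms] \<Psi>[OF assms] by (simp_all add: Hom_def)

lemma \<Psi>_\<Phi>_cancel:
  "\<lbrakk>X \<in> Ob D; x \<in> Mor C; Tgt C x = Fob G (Fob S' X)\<rbrakk> \<Longrightarrow> \<Psi> X \<cdot>\<^bsub>C\<^esub> \<Phi> X \<cdot>\<^bsub>C\<^esub> x = x"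
  by (rule cod.Cmp_cancel[OF \<Psi>_\<Phi>]) simp_all

lemma \<Phi>_\<Psi>_cancel:
  "\<lbrakk>X \<in> Ob D; x \<in> Mor C; Tgt C x = Fob S (Fob G X)\<rbrakk> \<Longrightarrow> \<Phi> X \<cdot>\<^bsub>C\<^esub> \<Psi> X \<cdot>\<^bsub>C\<^esub> x = x"
  by (rule cod.Cmp_cancel[OF \<Phi>_\<Psi>]) simp_all

lemmas \<Phi>_inverse [simp] = \<Psi>_\<Phi> \<Phi>_\<Psi> \<Psi>_\<Phi>_cancel \<Phi>_\<Psi>_cancel

lemma \<Phi>_natural:
  assumes "f \<in> Mor D" "Tgt D f = Y"
  shows "\<Phi> Y \<cdot>\<^bsub>C\<^esub> Fmor G (Fmor S' f) = Fmor S (Fmor G f) \<cdot>\<^bsub>C\<^esub> \<Phi> (Src D f)"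
  using natural_iso_arrow(5)[OF \<Phi>, of f] assms by simp

lemma \<Phi>_natural_assoc:
  assumes "f \<in> Mor D" "Tgt D f = Y" "x \<in> Mor C" "Tgt C x = Fob G (Fob S' (Src D f))"
  shows "\<Phi> Y \<cdot>\<^bsub>C\<^esub> Fmor G (Fmor S' f) \<cdot>\<^bsub>C\<^esub> x = Fmor S (Fmor G f) \<cdot>\<^bsub>C\<^esub> \<Phi> (Src D f) \<cdot>\<^bsub>C\<^esub> x"
proof -
  have "Y \<in> Ob D" using assms by auto
  have "\<Phi> Y \<cdot>\<^bsub>C\<^esub> Fmor G (Fmor S' f) \<cdot>\<^bsub>C\<^esub> x = (\<Phi> Y \<cdot>\<^bsub>C\<^esub> Fmor G (Fmor S' f)) \<cdot>\<^bsub>C\<^esub> x"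
    using assms \<open>Y \<in> Ob D\<close> by simp
  also have "\<dots> = (Fmor S (Fmor G f) \<cdot>\<^bsub>C\<^esub> \<Phi> (Src D f)) \<cdot>\<^bsub>C\<^esub> x"
    by (simp only: \<Phi>_natural assms)
  finally show ?thesis using assms by simp
qed

abbreviation K :: "'q list \<Rightarrow> 'm list" where
  "K \<equiv> map_seq D C G \<Phi>"

text \<open>The condition on \<open>X\<close> itself is essential: \<open>G\<close> may identify
  distinct objects and is unspecified outside \<open>D\<close>, so \<open>K X\<close> can be a
  sequence without \<open>X\<close> being one.\<close>

definition T' :: "'q list set" where
  "T' = {X. sigma_seq D n S' X \<and> K X \<in> T}"

lemma K_arrow [simp]:
  assumes "sigma_seq D n S' X"
  shows "length (K X) = Suc (Suc n)"
    "i \<le> n \<Longrightarrow> K X ! i = Fmor G (X ! i)"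
    "K X ! 0 = Fmor G (X ! 0)"
    "K X ! Suc 0 = Fmor G (X ! Suc 0)"
    "K X ! Suc n = \<Phi> (Src D (X ! 0)) \<cdot>\<^bsub>C\<^esub> Fmor G (X ! Suc n)"
    "i \<le> Suc n \<Longrightarrow> K X ! i \<in> Mor C"
    "i \<le> Suc n \<Longrightarrow> Src C (K X ! i) = Fob G (Src D (X ! i))"
    "sigma_seq C n S (K X)"
  using map_seq_nth[OF sigma_seqD(1)[OF assms], where C = D and D = C and F = G and \<Theta> = \<Phi>]
    map_seq_arrow[OF dom.category_axioms cod.category_axioms G S' S \<Phi> assms] n_pos
  by auto

text \<open>The inner squares are images under \<open>G\<close> and are reflected by faithfulness.
  In the closing square, naturality brings both sides to the form \<open>\<Phi>\<close> at the first
  object of \<open>Y\<close> after an image under \<open>G\<close>, and \<open>\<Psi>\<close>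
  cancels the common factor.\<close>

lemma K_seq_mor_iff:
  assumes X: "sigma_seq D n S' X" and Y: "sigma_seq D n S' Y"
    and f: "length f = Suc (Suc n)" "\<And>i. i \<le> Suc n \<Longrightarrow> f ! i \<in> Mor D"
      "\<And>i. i \<le> Suc n \<Longrightarrow> Src D (f ! i) = Src D (X ! i)"
      "\<And>i. i \<le> Suc n \<Longrightarrow> Tgt D (f ! i) = Src D (Y ! i)"
  shows "seq_mor C n S (K X) (K Y) (map (Fmor G) f) \<longleftrightarrow> seq_mor D n S' X Y f"
proof -
  note [simp] = sigma_seqD[OF X] sigma_seqD[OF Y] f X Y
  have 1: "Fmor G (f ! Suc i) \<cdot>\<^bsub>C\<^esub> K X ! i = K Y ! i \<cdot>\<^bsub>C\<^esub> Fmor G (f ! i) \<longleftrightarrow>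
      f ! Suc i \<cdot>\<^bsub>D\<^esub> X ! i = Y ! i \<cdot>\<^bsub>D\<^esub> f ! i" if "i \<le> n" for i
  proof -
    have "Fmor G (f ! Suc i) \<cdot>\<^bsub>C\<^esub> K X ! i = Fmor G (f ! Suc i \<cdot>\<^bsub>D\<^esub> X ! i)"
      "K Y ! i \<cdot>\<^bsub>C\<^esub> Fmor G (f ! i) = Fmor G (Y ! i \<cdot>\<^bsub>D\<^esub> f ! i)"
      using that by simp_all
    moreover have "f ! Suc i \<cdot>\<^bsub>D\<^esub> X ! i = Y ! i \<cdot>\<^bsub>D\<^esub> f ! i"
      if "Fmor G (f ! Suc i \<cdot>\<^bsub>D\<^esub> X ! i) = Fmor G (Y ! i \<cdot>\<^bsub>D\<^esub> f ! i)"
      by (rule faithful[OF that]) (use \<open>i \<le> n\<close> in simp_all)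
    ultimately show ?thesis by metis
  qed
  let ?a = "Fmor S' (f ! 0) \<cdot>\<^bsub>D\<^esub> X ! Suc n" and ?b = "Y ! Suc n \<cdot>\<^bsub>D\<^esub> f ! Suc n"
  let ?\<Phi> = "\<Phi> (Src D (Y ! 0))" and ?\<Psi> = "\<Psi> (Src D (Y ! 0))"
  have a: "Fmor S (Fmor G (f ! 0)) \<cdot>\<^bsub>C\<^esub> K X ! Suc n = ?\<Phi> \<cdot>\<^bsub>C\<^esub> Fmor G ?a"
    by (simp add: \<Phi>_natural_assoc)
  have b: "K Y ! Suc n \<cdot>\<^bsub>C\<^esub> Fmor G (f ! Suc n) = ?\<Phi> \<cdot>\<^bsub>C\<^esub> Fmor G ?b"
    by simp
  have "?a = ?b" if "?\<Phi> \<cdot>\<^bsub>C\<^esub> Fmor G ?a = ?\<Phi> \<cdot>\<^bsub>C\<^esub> Fmor G ?b"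
  proof (rule faithful)
    have "?\<Psi> \<cdot>\<^bsub>C\<^esub> ?\<Phi> \<cdot>\<^bsub>C\<^esub> Fmor G ?a = ?\<Psi> \<cdot>\<^bsub>C\<^esub> ?\<Phi> \<cdot>\<^bsub>C\<^esub> Fmor G ?b" using that by simp
    then show "Fmor G ?a = Fmor G ?b"
      by (subst (asm) (1 2) \<Psi>_\<Phi>_cancel) simp_all
  qed simp_all
  then have 2: "Fmor S (Fmor G (f ! 0)) \<cdot>\<^bsub>C\<^esub> K X ! Suc n = K Y ! Suc n \<cdot>\<^bsub>C\<^esub> Fmor G (f ! Suc n)
      \<longleftrightarrow> ?a = ?b" unfolding a b by metis
  show ?thesis
  proof
    assume *: "seq_mor C n S (K X) (K Y) (map (Fmor G) f)"
    show "seq_mor D n S' X Y f"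
    proof (rule seq_morI)
      fix i assume "i \<le> n"
      then show "f ! Suc i \<cdot>\<^bsub>D\<^esub> X ! i = Y ! i \<cdot>\<^bsub>D\<^esub> f ! i"
        using seq_morD(5)[OF *, of i] 1[of i] by (simp del: K_arrow)
    next
      show "?a = ?b" using seq_morD(6)[OF *] 2 by (simp del: K_arrow)
    qed simp_all
  next
    assume *: "seq_mor D n S' X Y f"
    show "seq_mor C n S (K X) (K Y) (map (Fmor G) f)"
    proof (rule seq_morI)
      fix i assume "i \<le> n"
      then show "map (Fmor G) f ! Suc i \<cdot>\<^bsub>C\<^esub> K X ! i = K Y ! i \<cdot>\<^bsub>C\<^esub> map (Fmor G) f ! i"
        using seq_morD(5)[OF *, of i] 1[of i] by (simp del: K_arrow)
    next
      show "Fmor S (map (Fmor G) f ! 0) \<cdot>\<^bsub>C\<^esub> K X ! Suc n = K Y ! Suc n \<cdot>\<^bsub>C\<^esub> map (Fmor G) f ! Suc n"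
        using seq_morD(6)[OF *] 2 by (simp del: K_arrow)
    qed simp_all
  qed
qed

lemma K_seq_mor:
  assumes "sigma_seq D n S' X" "sigma_seq D n S' Y" "seq_mor D n S' X Y f"
  shows "seq_mor C n S (K X) (K Y) (map (Fmor G) f)"
  using K_seq_mor_iff[OF assms(1,2) seq_morD(1-4)[OF assms(3)]] assms(3) by blast

text \<open>Fullness lifts the components one by one; commutativity of the lifted squares is then
  reflected.\<close>

lemma K_seq_mor_full:
  assumes X: "sigma_seq D n S' X" and Y: "sigma_seq D n S' Y" and g: "seq_mor C n S (K X) (K Y) g"
  obtains f where "seq_mor D n S' X Y f" "g = map (Fmor G) f"
proof -
  note [simp] = sigma_seqD[OF X] sigma_seqD[OF Y] seq_morD(1-4)[OF g] X Y
  define f where "f = map (\<lambda>i. lift_mor (Src D (X ! i)) (Src D (Y ! i)) (g ! i)) [0..<Suc (Suc n)]"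
  have f: "length f = Suc (Suc n)"
    "i \<le> Suc n \<Longrightarrow> f ! i = lift_mor (Src D (X ! i)) (Src D (Y ! i)) (g ! i)" for i
    by (simp_all add: f_def del: upt_Suc)
  have gf: "g = map (Fmor G) f"
    by (rule nth_equalityI) (simp_all add: f less_Suc_eq_le)
  have "seq_mor D n S' X Y f"
    using g K_seq_mor_iff[OF X Y, of f] unfolding gf[symmetric] by (simp add: f)
  then show ?thesis using gf that by blast
qed

lemma K_direct_sum:
  assumes "seq_direct_sum D A' n S' X Y W"
  shows "seq_direct_sum C A n S (K X) (K Y) (K W)"
proof -
  have X: "sigma_seq D n S' X" and Y: "sigma_seq D n S' Y" and W: "sigma_seq D n S' W"
    using assms by (simp_all add: seq_direct_sum_def)
  obtain i1 i2 p1 p2 where m: "seq_mor D n S' X W i1" "seq_mor D n S' Y W i2"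
      "seq_mor D n S' W X p1" "seq_mor D n S' W Y p2"
    and b: "\<And>k. k \<le> n + 1 \<Longrightarrow> is_biproduct D A' (Src D (X ! k)) (Src D (Y ! k))
           \<lparr>Bob = Src D (W ! k), In1 = i1 ! k, In2 = i2 ! k, Pr1 = p1 ! k, Pr2 = p2 ! k\<rparr>"
    using assms unfolding seq_direct_sum_def by blast
  have "is_biproduct C A (Src C (K X ! k)) (Src C (K Y ! k))
      \<lparr>Bob = Src C (K W ! k), In1 = map (Fmor G) i1 ! k, In2 = map (Fmor G) i2 ! k,
       Pr1 = map (Fmor G) p1 ! k, Pr2 = map (Fmor G) p2 ! k\<rparr>" if "k \<le> n + 1" for k
    using G_biproduct[OF b[OF that]] that m[THEN seq_morD(1)]
    by (simp add: map_biproduct_def X Y W del: K_arrow(2-5))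
  then show ?thesis
    unfolding seq_direct_sum_def using K_seq_mor m X Y W K_arrow(8) by blast
qed

lemma sigma_seq_trivial:
  assumes "x \<in> Ob D" "z \<in> Ob D"
  shows "sigma_seq D n S' (trivial_seq D A' n S' x z)"
proof (rule sigma_seqI)
  note nth = trivial_seq_nth[OF n_pos]
  let ?X = "trivial_seq D A' n S' x z"
  have 0: "?X ! 0 \<in> Mor D" "Src D (?X ! 0) = x" "Tgt D (?X ! 0) = Src D (?X ! Suc 0)"
    using assms by (simp_all add: nth)
  \<comment> \<open>Targets equal \<open>z\<close> at positions \<open>1\<close> to
    \<open>n\<close>, sources at positions \<open>2\<close> to \<open>n + 1\<close>. The ranges are
    shifted by one, exactly as composability of consecutive entries requires.\<close>
  have 1: "?X ! i \<in> Mor D \<and> Tgt D (?X ! i) = z" if "0 < i" "i \<le> n" for i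
  proof (cases "Suc 0 < i")
    case True
    then show ?thesis using assms that by (simp add: nth(4))
  next
    case False
    then have "i = Suc 0" using that by simp
    then show ?thesis using assms by (simp add: nth(3))
  qed
  have 2: "?X ! i \<in> Mor D \<and> Src D (?X ! i) = z" if "Suc 0 < i" "i \<le> Suc n" for i
    using assms that by (cases "i = Suc n") (simp_all add: nth(4,5))
  fix i
  show "?X ! i \<in> Mor D" if "i \<le> Suc n"
    using that n_pos 0(1) 1[of i] 2[of i] by (cases "i = 0"; cases "i \<le> n") simp_all
  show "Tgt D (?X ! i) = Src D (?X ! Suc i)" if "i \<le> n"
    using that 0(3) 1[of i] 2[of "Suc i"] by (cases "i = 0") simp_all
qed (use assms in \<open>simp_all add: trivial_seq_nth[OF n_pos]\<close>)

text \<open>No isomorphism intervenes: \<open>\<Phi>\<close> after a zero morphism is the zero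
  morphism with the corrected target.\<close>

lemma K_trivial:
  assumes "x \<in> Ob D" "z \<in> Ob D"
  shows "K (trivial_seq D A' n S' x z) = trivial_seq C A n S (Fob G x) (Fob G z)"
  using assms by (simp add: map_seq_def trivial_seq_def butlast_append map_replicate)


lemma T'_iff: "sigma_seq D n S' X \<Longrightarrow> X \<in> T' \<longleftrightarrow> K X \<in> T"
  by (simp add: T'_def)

text \<open>Rotation and \<open>K\<close> commute up to the isomorphism that is \<open>\<Phi>\<close> in the last position.\<close>

lemma T'_rotation:
  assumes X: "sigma_seq D n S' X"
  shows "X \<in> T' \<longleftrightarrow> rotation D A' n S' X \<in> T'"
proof -
  let ?R = "rotation D A' n S' X" and ?R' = "rotation C A n S (K X)"
  have R: "sigma_seq D n S' ?R" by (rule dom.rotation_sigma_seq[OF S' X])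
  have R': "sigma_seq C n S ?R'" by (rule cod.rotation_sigma_seq[OF S K_arrow(8)[OF X]])
  note [simp] = sigma_seqD[OF X] rotation_nth[OF sigma_seqD(1)[OF X]]
    rotation_nth[OF K_arrow(1)[OF X]] X R
  let ?x = "Src D (X ! 0)"
  define t where "t = map (\<lambda>i. if i \<le> n then Idn C (Fob G (Src D (X ! Suc i))) else \<Phi> ?x) [0..<Suc (Suc n)]"
  have t [simp]: "length t = Suc (Suc n)" "i \<le> n \<Longrightarrow> t ! i = Idn C (Fob G (Src D (X ! Suc i)))"
    "t ! 0 = Idn C (Fob G (Src D (X ! Suc 0)))"  "t ! Suc n = \<Phi> ?x" for i
    by (simp_all add: t_def del: upt_Suc)
  have "seq_mor C n S (K ?R) ?R' t"
  proof (rule seq_morI)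
    fix i
    show "t ! i \<in> Mor C" "Src C (t ! i) = Src C (K ?R ! i)" "Tgt C (t ! i) = Src C (?R' ! i)"
      if "i \<le> Suc n"
      using that by (cases "i = Suc n"; simp)+
    \<comment> \<open>At \<open>i = n\<close> the component \<open>\<Phi> ?x\<close> of
      \<open>t\<close> supplies the factor that \<open>K X\<close> carries in its last morphism and
      that \<open>K ?R\<close> lacks in this position.\<close>
    show "t ! Suc i \<cdot>\<^bsub>C\<^esub> K ?R ! i = ?R' ! i \<cdot>\<^bsub>C\<^esub> t ! i" if "i \<le> n"
      using that by (cases "i = n") simp_all
  next
    \<comment> \<open>This is naturality of \<open>\<Phi>\<close> at the first morphism of
      \<open>X\<close>; for odd \<open>n\<close> the sign is pulled out of both composites.\<close>
    show "Fmor S (t ! 0) \<cdot>\<^bsub>C\<^esub> K ?R ! Suc n = ?R' ! Suc n \<cdot>\<^bsub>C\<^esub> t ! Suc n"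
      by (simp add: \<Phi>_natural cod.Cmp_Neg cod.Neg_Cmp)
  qed simp_all
  moreover have "isomorphism_in C (t ! k)" if "k \<le> Suc n" for k
    using that natural_iso_arrow(4)[OF \<Phi>, of ?x]
    by (cases "k = Suc n") (simp_all add: cod.iso_Idn)
  ultimately have "K ?R \<in> T \<longleftrightarrow> ?R' \<in> T"
    by (intro cod.T_iso[of _ _ t]) (simp_all add: R')
  then show ?thesis
    using cod.F2[of "K X"] by (simp add: T'_iff)
qed

text \<open>An angle of \<open>C\<close> that starts with \<open>G f\<close> need not be of the form
  \<open>K Y\<close>, so its objects are replaced by isomorphic ones in the image of
  \<open>G\<close>. In positions 0 and 1 the replacement is the identity, which keeps the first
  morphism equal to \<open>f\<close>.\<close>

lemma T'_first:
  assumes f: "f \<in> Mor D"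
  shows "\<exists>X \<in> T'. X ! 0 = f"
proof -
  obtain X where X: "X \<in> T" "X ! 0 = Fmor G f" using cod.F1_first[of "Fmor G f"] f by auto
  note sX = cod.T_sigma_seq[OF X(1)]
  note [simp] = sigma_seqD[OF sX] X(2) f
  have [simp]: "Src C (X ! Suc 0) = Fob G (Tgt D f)"
    using sigma_seqD(3)[OF sX, of 0] by simp
  define Q where "Q k P u \<longleftrightarrow>
    P \<in> Ob D \<and> isomorphism_in C u \<and> Src C u = Fob G P \<and> Tgt C u = Src C (X ! k) \<and>
    (k = 0 \<longrightarrow> P = Src D f \<and> u = Idn C (Fob G P)) \<and>
    (k = 1 \<longrightarrow> P = Tgt D f \<and> u = Idn C (Fob G P))" for k P u
  have "\<exists>P u. Q k P u" if "k \<le> Suc n" for k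
  proof -
    consider "k = 0" | "k = 1" | "k \<noteq> 0" "k \<noteq> 1" by blast
    then show ?thesis
    proof cases
      case 1
      then show ?thesis
        by (intro exI[of _ "Src D f"] exI[of _ "Idn C (Fob G (Src D f))"]) (simp add: Q_def cod.iso_Idn)
    next
      case 2
      then show ?thesis
        by (intro exI[of _ "Tgt D f"] exI[of _ "Idn C (Fob G (Tgt D f))"]) (simp add: Q_def cod.iso_Idn)
    next
      case 3
      then show ?thesis using ess_surj[of "Src C (X ! k)"] that by (simp add: Q_def)
    qed
  qed
  then obtain P u where "\<And>k. k \<le> Suc n \<Longrightarrow> Q k (P k) (u k)" by metis
  then have Pu: "P k \<in> Ob D" "isomorphism_in C (u k)" "Src C (u k) = Fob G (P k)"
    "Tgt C (u k) = Src C (X ! k)" "k = 0 \<Longrightarrow> P k = Src D f \<and> u k = Idn C (Fob G (P k))"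
    "k = 1 \<Longrightarrow> P k = Tgt D f \<and> u k = Idn C (Fob G (P k))" if "k \<le> Suc n" for k
    using that unfolding Q_def by blast+
  define R where "R k v \<longleftrightarrow>
      u k \<in> Mor C \<and> v \<in> Mor C \<and> Src C v = Src C (X ! k) \<and> Tgt C v = Fob G (P k) \<and>
      u k \<cdot>\<^bsub>C\<^esub> v = Idn C (Src C (X ! k)) \<and> (k = 1 \<longrightarrow> v = Idn C (Fob G (P k)))" for k v
  have "\<exists>v. R k v" if k: "k \<le> Suc n" for k
  proof -
    obtain v where v: "u k \<in> Mor C" "v \<in> Mor C" "Src C v = Tgt C (u k)" "Tgt C v = Src C (u k)"
      "u k \<cdot>\<^bsub>C\<^esub> v = Idn C (Tgt C (u k))"
      using Pu(2)[OF k] by (rule cod.isoE)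
    have "v = Idn C (Fob G (P k))" if "k = 1"
      using v Pu[OF k] that by simp
    then show ?thesis unfolding R_def using v Pu[OF k] by metis
  qed
  then obtain v where "\<And>k. k \<le> Suc n \<Longrightarrow> R k (v k)" by metis
  then have v: "u k \<in> Mor C" "v k \<in> Mor C" "Src C (v k) = Src C (X ! k)"
      "Tgt C (v k) = Fob G (P k)" "u k \<cdot>\<^bsub>C\<^esub> v k = Idn C (Src C (X ! k))"
      "k = 1 \<Longrightarrow> v k = Idn C (Fob G (P k))" if "k \<le> Suc n" for k
    using that unfolding R_def by blast+
  have P01 [simp]: "P 0 = Src D f" "u 0 = Idn C (Fob G (Src D f))" "P (Suc 0) = Tgt D f"
    "v (Suc 0) = Idn C (Fob G (Tgt D f))"
    using Pu(5)[of 0] Pu(6)[of 1] v(6)[of 1] by simp_all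
  note [simp] = Pu(1,3,4) v(1-5)
  \<comment> \<open>The morphisms of \<open>X\<close> are conjugated by the chosen isomorphisms and
    lifted. The last one already ends in \<open>S (G (Src D f))\<close> because \<open>u 0\<close>
    is an identity; \<open>\<Psi>\<close> moves its target into the image of \<open>G\<close> and is
    cancelled by the \<open>\<Phi>\<close> that \<open>K\<close> inserts.\<close>
  define Y where "Y = map (\<lambda>k. if k \<le> n
      then lift_mor (P k) (P (Suc k)) (v (Suc k) \<cdot>\<^bsub>C\<^esub> X ! k \<cdot>\<^bsub>C\<^esub> u k)
      else lift_mor (P k) (Fob S' (Src D f)) (\<Psi> (Src D f) \<cdot>\<^bsub>C\<^esub> X ! k \<cdot>\<^bsub>C\<^esub> u k)) [0..<Suc (Suc n)]"
  have Y: "length Y = Suc (Suc n)"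
    "k \<le> n \<Longrightarrow> Y ! k = lift_mor (P k) (P (Suc k)) (v (Suc k) \<cdot>\<^bsub>C\<^esub> X ! k \<cdot>\<^bsub>C\<^esub> u k)"
    "Y ! Suc n = lift_mor (P (Suc n)) (Fob S' (Src D f)) (\<Psi> (Src D f) \<cdot>\<^bsub>C\<^esub> X ! Suc n \<cdot>\<^bsub>C\<^esub> u (Suc n))" for k
    by (simp_all add: Y_def del: upt_Suc)
  have Y0: "Y ! 0 = f"
    by (rule faithful) (use Y(2)[of 0] in simp_all)
  have YM: "Y ! k \<in> Mor D" "Src D (Y ! k) = P k" if "k \<le> Suc n" for k
    using that by (cases "k = Suc n"; simp add: Y)+
  have sY: "sigma_seq D n S' Y"
  proof (rule sigma_seqI)
    fix i assume "i \<le> n"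
    then show "Tgt D (Y ! i) = Src D (Y ! Suc i)" using YM(2)[of "Suc i"] by (simp add: Y(2))
  qed (simp_all add: YM Y0, simp_all add: Y)
  note [simp] = sY
  have GY: "Fmor G (Y ! k) = v (Suc k) \<cdot>\<^bsub>C\<^esub> X ! k \<cdot>\<^bsub>C\<^esub> u k" if "k \<le> n" for k
    using that by (simp add: Y)
  have GY': "Fmor G (Y ! Suc n) = \<Psi> (Src D f) \<cdot>\<^bsub>C\<^esub> X ! Suc n \<cdot>\<^bsub>C\<^esub> u (Suc n)"
    by (simp add: Y)
  have uv: "u k \<cdot>\<^bsub>C\<^esub> v k \<cdot>\<^bsub>C\<^esub> x = x" if "k \<le> Suc n" "x \<in> Mor C" "Tgt C x = Src C (X ! k)" for k x
    by (rule cod.Cmp_cancel) (use that in simp_all)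
  define t where "t = map u [0..<Suc (Suc n)]"
  have t [simp]: "length t = Suc (Suc n)" "k \<le> Suc n \<Longrightarrow> t ! k = u k" "t ! 0 = u 0" for k
    by (simp_all add: t_def del: upt_Suc)
  have "seq_mor C n S (K Y) X t"
  proof (rule seq_morI)
    fix i assume "i \<le> n"
    then show "t ! Suc i \<cdot>\<^bsub>C\<^esub> K Y ! i = X ! i \<cdot>\<^bsub>C\<^esub> t ! i"
      by (simp add: GY uv)
  next
    show "Fmor S (t ! 0) \<cdot>\<^bsub>C\<^esub> K Y ! Suc n = X ! Suc n \<cdot>\<^bsub>C\<^esub> t ! Suc n"
      by (simp add: GY' Y0)
  qed (simp_all add: YM)
  then have "K Y \<in> T \<longleftrightarrow> X \<in> T"
    by (rule cod.T_iso[rotated 2]) (simp_all add: Pu(2) sX)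
  then show ?thesis using X(1) Y0 T'_iff[OF sY] by blast
qed

lemma T'_mor_full:
  assumes X: "X \<in> T'" and Y: "Y \<in> T'"
    and f0: "f0 \<in> Hom D (Src D (X ! 0)) (Src D (Y ! 0))"
    and f1: "f1 \<in> Hom D (Src D (X ! 1)) (Src D (Y ! 1))"
    and g: "seq_mor C n S (K X) (K Y) g" "g ! 0 = Fmor G f0" "g ! 1 = Fmor G f1"
  obtains f where "seq_mor D n S' X Y f" "g = map (Fmor G) f" "f ! 0 = f0" "f ! 1 = f1"
proof -
  have s: "sigma_seq D n S' X" "sigma_seq D n S' Y" using X Y by (simp_all add: T'_def)
  obtain f where f: "seq_mor D n S' X Y f" "g = map (Fmor G) f"
    using K_seq_mor_full[OF s g(1)] by blast
  note [simp] = seq_morD[OF f(1)]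
  have "f ! 0 = f0"
    by (rule faithful) (use f f0 g in \<open>simp_all add: Hom_def\<close>)
  moreover have "f ! 1 = f1"
    by (rule faithful) (use f f1 g in \<open>simp_all add: Hom_def\<close>)
  ultimately show ?thesis using that f by blast
qed

text \<open>Collects the premises that (F3) and (F4) in \<open>C\<close> require for
  \<open>K X\<close> and \<open>K Y\<close>.\<close>

lemma T'_square:
  assumes X: "X \<in> T'" and Y: "Y \<in> T'"
    and f0: "f0 \<in> Hom D (Src D (X ! 0)) (Src D (Y ! 0))"
    and f1: "f1 \<in> Hom D (Src D (X ! 1)) (Src D (Y ! 1))"
    and sq: "f1 \<cdot>\<^bsub>D\<^esub> X ! 0 = Y ! 0 \<cdot>\<^bsub>D\<^esub> f0"
  shows "K X \<in> T" "K Y \<in> T"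
    "Fmor G f0 \<in> Hom C (Src C (K X ! 0)) (Src C (K Y ! 0))"
    "Fmor G f1 \<in> Hom C (Src C (K X ! 1)) (Src C (K Y ! 1))"
    "Fmor G f1 \<cdot>\<^bsub>C\<^esub> K X ! 0 = K Y ! 0 \<cdot>\<^bsub>C\<^esub> Fmor G f0"
proof -
  have s: "sigma_seq D n S' X" "sigma_seq D n S' Y" using X Y by (simp_all add: T'_def)
  show "K X \<in> T" "K Y \<in> T" using X Y by (simp_all add: T'_def)
  note [simp] = s sigma_seqD[OF s(1)] sigma_seqD[OF s(2)]
  have t: "Tgt D (X ! 0) = Src D (X ! 1)" "Tgt D (Y ! 0) = Src D (Y ! 1)" by simp_all
  show "Fmor G f0 \<in> Hom C (Src C (K X ! 0)) (Src C (K Y ! 0))"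
    "Fmor G f1 \<in> Hom C (Src C (K X ! 1)) (Src C (K Y ! 1))"
    using f0 f1 by (simp_all add: Hom_def)
  show "Fmor G f1 \<cdot>\<^bsub>C\<^esub> K X ! 0 = K Y ! 0 \<cdot>\<^bsub>C\<^esub> Fmor G f0"
    using functor_arrow(6)[OF G, of "X ! 0" f1] functor_arrow(6)[OF G, of f0 "Y ! 0"] sq f0 f1 t
    by (simp add: Hom_def del: G_arrow(6))
qed

lemma weak_pre_angulated: "weak_pre_angulated_category D A' n S' T'"
proof (intro weak_pre_angulated_category.intro weak_pre_angulated_category_axioms.intro
    dom.additive_category_axioms autoequivalence_S')
  fix X assume "X \<in> T'"
  then show "sigma_seq D n S' X" by (simp add: T'_def)
next
  fix X assume X: "sigma_seq D n S' X" and z: "\<And>i. i \<le> n + 1 \<Longrightarrow> zero_object D (Src D (X ! i))"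
  have "K X \<in> T"
    by (rule cod.F1_zero) (use X z G_zero_object in \<open>simp_all del: K_arrow(2-5)\<close>)
  then show "X \<in> T'" using X by (simp add: T'_def)
next
  fix X Y W assume "seq_direct_sum D A' n S' X Y W" "X \<in> T'" "Y \<in> T'"
  moreover from this have "sigma_seq D n S' W" by (simp add: seq_direct_sum_def)
  ultimately show "W \<in> T'"
    using cod.F1_sum[OF K_direct_sum] unfolding T'_def by blast
next
  fix X Y W assume "seq_direct_sum D A' n S' X Y W" "W \<in> T'"
  moreover from this have "sigma_seq D n S' X" "sigma_seq D n S' Y"
    by (simp_all add: seq_direct_sum_def)
  ultimately show "X \<in> T' \<and> Y \<in> T'"
    using cod.F1_summand[OF K_direct_sum] unfolding T'_def by blast
next
  fix x z assume "x \<in> Ob D" "zero_object D z"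
  then show "trivial_seq D A' n S' x z \<in> T'"
    using cod.F1_trivial[OF _ G_zero_object] sigma_seq_trivial K_trivial
    by (auto simp: T'_def zero_object_def)
next
  fix f assume "f \<in> Mor D"
  then show "\<exists>X \<in> T'. X ! 0 = f" by (rule T'_first)
next
  fix X assume "sigma_seq D n S' X"
  then show "X \<in> T' \<longleftrightarrow> rotation D A' n S' X \<in> T'" by (rule T'_rotation)
next
  fix X Y f0 f1
  assume *: "X \<in> T'" "Y \<in> T'" "f0 \<in> Hom D (Src D (X ! 0)) (Src D (Y ! 0))"
    "f1 \<in> Hom D (Src D (X ! 1)) (Src D (Y ! 1))" "f1 \<cdot>\<^bsub>D\<^esub> X ! 0 = Y ! 0 \<cdot>\<^bsub>D\<^esub> f0"
  obtain g where "seq_mor C n S (K X) (K Y) g" "g ! 0 = Fmor G f0" "g ! 1 = Fmor G f1"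
    using cod.F3[OF T'_square[OF *]] by blast
  then obtain f where "seq_mor D n S' X Y f" "f ! 0 = f0" "f ! 1 = f1"
    by (rule T'_mor_full[OF *(1-4)])
  then show "\<exists>f. seq_mor D n S' X Y f \<and> f ! 0 = f0 \<and> f ! 1 = f1" by blast
qed

text \<open>The last biproduct of the cone of \<open>K X \<rightarrow> K Y\<close> has first summand \<open>S (G X\<^sup>0)\<close> instead of
  \<open>G (S' X\<^sup>0)\<close>; transporting it along \<open>\<Phi>\<close> makes \<open>K\<close> commute strictly with cones.\<close>

definition K_biproducts :: "'q list \<Rightarrow> (nat \<Rightarrow> ('p, 'q) biproduct) \<Rightarrow> nat \<Rightarrow> ('o, 'm) biproduct" where
  "K_biproducts X B i = (if i \<le> n then map_biproduct G (B i) else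
     \<lparr>Bob = Fob G (Bob (B i)),
      In1 = Fmor G (In1 (B i)) \<cdot>\<^bsub>C\<^esub> \<Psi> (Src D (X ! 0)), In2 = Fmor G (In2 (B i)),
      Pr1 = \<Phi> (Src D (X ! 0)) \<cdot>\<^bsub>C\<^esub> Fmor G (Pr1 (B i)), Pr2 = Fmor G (Pr2 (B i))\<rparr>)"

text \<open>Only index \<open>n + 1\<close> differs from an image under \<open>G\<close>. There the
  factors \<open>\<Phi>\<close> and \<open>\<Psi>\<close> cancel each other or are absorbed by zero
  morphisms.\<close>

lemma K_biproducts:
  assumes X: "sigma_seq D n S' X" and Y: "sigma_seq D n S' Y"
    and B: "cone_biproducts D A' n S' X Y B"
  shows "cone_biproducts C A n S (K X) (K Y) (K_biproducts X B)"
proof (rule cone_biproductsI)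
  note [simp] = X Y sigma_seqD[OF X] sigma_seqD[OF Y]
  note b = cone_biproductsD[OF B sigma_seqD(1)[OF X]]
  show "is_biproduct C A (Src C (K X ! Suc i)) (Src C (K Y ! i)) (K_biproducts X B i)" if "i \<le> n" for i
    using G_biproduct[OF b(1)[OF that]] that by (simp add: K_biproducts_def del: K_arrow(2-5))
  let ?B = "map_biproduct G (B (Suc n))"
  have "is_biproduct C A (Fob G (Fob S' (Src D (X ! 0)))) (Fob G (Src D (Y ! Suc n))) ?B"
    using G_biproduct[OF b(2)] by simp
  note b [simp] = cod.is_biproduct_arrow[OF this, unfolded map_biproduct_def, simplified]
  have [simp]: "Fmor G (Pr1 (B (Suc n))) \<cdot>\<^bsub>C\<^esub> Fmor G (In1 (B (Suc n))) \<cdot>\<^bsub>C\<^esub> x = x"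
    if "x \<in> Mor C" "Tgt C x = Fob G (Fob S' (Src D (X ! 0)))" for x
    by (rule cod.Cmp_cancel) (use that in simp_all)
  have [simp]: "Fmor G (Pr2 (B (Suc n))) \<cdot>\<^bsub>C\<^esub> Fmor G (In1 (B (Suc n))) \<cdot>\<^bsub>C\<^esub> x
      = Zero A (Src C x) (Fob G (Src D (Y ! Suc n)))"
    if "x \<in> Mor C" "Tgt C x = Fob G (Fob S' (Src D (X ! 0)))" for x
    using that cod.Cmp_arrow_assoc[of x "Fmor G (In1 (B (Suc n)))" "Fmor G (Pr2 (B (Suc n)))"]
    by simp
  show "is_biproduct C A (Src C (Fmor S (K X ! 0))) (Src C (K Y ! Suc n)) (K_biproducts X B (Suc n))"
    by (rule cod.is_biproductI) (simp_all add: K_biproducts_def)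
qed (rule K_arrow(1)[OF X])

lemma cone_sigma_seq:
  assumes X: "sigma_seq D n S' X" and Y: "sigma_seq D n S' Y" and f: "seq_mor D n S' X Y f"
    and B: "cone_biproducts D A' n S' X Y B"
  shows "sigma_seq D n S' (cone D A' n S' X Y f B)"
proof -
  note [simp] = X Y sigma_seqD[OF X] sigma_seqD[OF Y] seq_morD(1-4)[OF f]
  note b = cone_biproductsD[OF B sigma_seqD(1)[OF X]]
  note c = cone_nth[OF sigma_seqD(1)[OF X] seq_morD(1)[OF f], where C = D and A = A' and S = S' and Y = Y and B = B]
  \<comment> \<open>The last matrix has the image of \<open>B 0\<close> under \<open>S'\<close> as
    its codomain, so \<open>S'\<close> must preserve biproducts for it to be well typed.\<close>
  interpret S': ff_ess_surj_additive2 D D S' A' A'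
    by (intro ff_ess_surj_additive2.intro dom.additive_category_axioms
        is_equivalence_imp_ff_ess_surj dom.category_axioms autoequivalence_S')
  have 1: "cone D A' n S' X Y f B ! i \<in> Mor D \<and> Src D (cone D A' n S' X Y f B ! i) = Bob (B i)
      \<and> Tgt D (cone D A' n S' X Y f B ! i) = Bob (B (Suc i))" if i: "i \<le> n" for i
  proof -
    have "is_biproduct D A' (Tgt D (X ! Suc i)) (Src D (Y ! Suc i)) (B (Suc i))"
      using b(1)[of "Suc i"] b(2) i by (cases "i = n") simp_all
    note m = dom.matrix_mor_arrow[OF b(1)[OF i] this]
    show ?thesis unfolding c(2)[OF i] using i by (intro conjI m) simp_all
  qed
  have 2: "cone D A' n S' X Y f B ! Suc n \<in> Mor D
      \<and> Src D (cone D A' n S' X Y f B ! Suc n) = Bob (B (Suc n))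
      \<and> Tgt D (cone D A' n S' X Y f B ! Suc n) = Bob (map_biproduct S' (B 0))"
  proof -
    note m = dom.matrix_mor_arrow[OF b(2) S'.G_biproduct[OF b(1)[of 0]]]
    show ?thesis unfolding c(3) by (intro conjI m) simp_all
  qed
  show ?thesis
  proof (rule sigma_seqI)
    fix i
    show "cone D A' n S' X Y f B ! i \<in> Mor D" if "i \<le> Suc n"
      using that 1[of i] 2 by (cases "i = Suc n") simp_all
    show "Tgt D (cone D A' n S' X Y f B ! i) = Src D (cone D A' n S' X Y f B ! Suc i)" if "i \<le> n"
      using that 1[of i] 1[of "Suc i"] 2 by (cases "i = n") simp_all
  qed (use c(1) 1[of 0] 2 in \<open>simp_all add: map_biproduct_def\<close>)
qed

text \<open>Both sides are expanded into sums of composites and compared position by position.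
  Because the biproducts were adapted to \<open>\<Phi>\<close>, the entries coincide and no
  comparison isomorphism of cones is needed.\<close>

lemma K_cone:
  assumes X: "sigma_seq D n S' X" and Y: "sigma_seq D n S' Y" and f: "seq_mor D n S' X Y f"
    and B: "cone_biproducts D A' n S' X Y B"
  shows "K (cone D A' n S' X Y f B) = cone C A n S (K X) (K Y) (map (Fmor G) f) (K_biproducts X B)"
    (is "K ?c = ?c'")
proof (rule nth_equalityI)
  note [simp] = X Y sigma_seqD[OF X] sigma_seqD[OF Y] seq_morD(1-4)[OF f]
  note b = cone_biproductsD[OF B sigma_seqD(1)[OF X]]
  note c = cone_nth[OF sigma_seqD(1)[OF X] seq_morD(1)[OF f], where C = D and A = A' and S = S' and Y = Y and B = B]
  have c': "length ?c' = Suc (Suc n)"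
    "i \<le> n \<Longrightarrow> ?c' ! i = matrix_mor C A (K_biproducts X B i) (K_biproducts X B (Suc i))
       (Neg C A (K X ! Suc i)) (Zero A (Src C (K Y ! i)) (Tgt C (K X ! Suc i)))
       (map (Fmor G) f ! Suc i) (K Y ! i)"
    "?c' ! Suc n = matrix_mor C A (K_biproducts X B (Suc n)) (map_biproduct S (K_biproducts X B 0))
       (Neg C A (Fmor S (K X ! 0))) (Zero A (Src C (K Y ! Suc n)) (Tgt C (Fmor S (K X ! 0))))
       (Fmor S (map (Fmor G) f ! 0)) (K Y ! Suc n)" for i
    by (simp_all add: cone_nth)
  have sc: "sigma_seq D n S' ?c" by (rule cone_sigma_seq[OF X Y f B])
  note Kc = K_arrow[OF sc]
  show "length (K ?c) = length ?c'" using Kc(1) c'(1) by simp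
  fix i assume "i < length (K ?c)"
  then consider "i < n" | "i = n" | "i = Suc n" using Kc(1) by linarith
  then show "K ?c ! i = ?c' ! i"
  proof cases
    case 1
    note [simp] = dom.is_biproduct_arrow[OF b(1)[of i]] dom.is_biproduct_arrow[OF b(1)[of "Suc i"]]
    show ?thesis
      using 1 Kc(2)[of i] c(2)[of i] c'(2)[of i]
      by (simp add: K_biproducts_def matrix_mor_def map_biproduct_def)
  next
    \<comment> \<open>The target is the adapted biproduct: \<open>\<Psi>\<close> in its first
      injection meets the \<open>\<Phi>\<close> in the last morphism of \<open>K X\<close>, once the
      sign has been moved out of the way.\<close>
    case 2
    note [simp] = dom.is_biproduct_arrow[OF b(1)[of n]] dom.is_biproduct_arrow[OF b(2)]
    show ?thesis
      using 2 Kc(2)[of n] c(2)[of n] c'(2)[of n]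
      by (simp add: K_biproducts_def matrix_mor_def map_biproduct_def cod.Cmp_Neg cod.Neg_Cmp)
  next
    case 3
    note [simp] = dom.is_biproduct_arrow[OF b(1)[of 0]] dom.is_biproduct_arrow[OF b(2)]
    \<comment> \<open>\<open>K\<close> inserts \<open>\<Phi>\<close> at the source of the first cone
      morphism, identified here as the object of \<open>B 0\<close>. Naturality then carries
      \<open>\<Phi>\<close> through the injections and the entries, down to the adapted projection
      or the last morphism of \<open>K Y\<close>.\<close>
    have "Suc 0 \<le> n" using n_pos by simp
    then have src: "Src D (?c ! 0) = Bob (B 0)"
      using dom.is_biproduct_arrow[OF b(1)[of "Suc 0"]] by (simp add: c(2) matrix_mor_def)
    show ?thesis
      unfolding 3 Kc(5) src c(3) c'(3)
      by (simp add: K_biproducts_def matrix_mor_def map_biproduct_def cod.Cmp_Neg cod.Neg_Cmp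
          \<Phi>_natural \<Phi>_natural_assoc)
  qed
qed

lemma weak_angulated:
  assumes "weak_angulated_category C A n S T"
  shows "weak_angulated_category D A' n S' T'"
proof (intro weak_angulated_category.intro weak_angulated_category_axioms.intro weak_pre_angulated)
  fix X Y f0 f1
  assume *: "X \<in> T'" "Y \<in> T'" "f0 \<in> Hom D (Src D (X ! 0)) (Src D (Y ! 0))"
    "f1 \<in> Hom D (Src D (X ! 1)) (Src D (Y ! 1))" "f1 \<cdot>\<^bsub>D\<^esub> X ! 0 = Y ! 0 \<cdot>\<^bsub>D\<^esub> f0"
  then have s: "sigma_seq D n S' X" "sigma_seq D n S' Y" by (simp_all add: T'_def)
  obtain g where g: "seq_mor C n S (K X) (K Y) g" "g ! 0 = Fmor G f0" "g ! 1 = Fmor G f1"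
    and cone: "\<And>B. cone_biproducts C A n S (K X) (K Y) B \<Longrightarrow> cone C A n S (K X) (K Y) g B \<in> T"
    using weak_angulated_category.F4[OF assms T'_square[OF *]] by blast
  \<comment> \<open>The morphism \<open>g\<close> was chosen before any biproducts, so one lift
    \<open>f\<close> works for every \<open>B\<close>.\<close>
  obtain f where f: "seq_mor D n S' X Y f" "g = map (Fmor G) f" "f ! 0 = f0" "f ! 1 = f1"
    by (rule T'_mor_full[OF *(1-4) g])
  have "cone D A' n S' X Y f B \<in> T'" if B: "cone_biproducts D A' n S' X Y B" for B
    using cone[OF K_biproducts[OF s B]] K_cone[OF s f(1) B] cone_sigma_seq[OF s f(1) B] f(2)
    by (simp add: T'_def)
  then show "\<exists>f. seq_mor D n S' X Y f \<and> f ! 0 = f0 \<and> f ! 1 = f1 \<and>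
      (\<forall>B. cone_biproducts D A' n S' X Y B \<longrightarrow> cone D A' n S' X Y f B \<in> T')"
    using f by blast
qed

end

text \<open>The whole instance of \<open>angle_pullback\<close> is returned, so that the weak
  pre-angulated and the weak angulated case are settled for the same \<open>T'\<close> as the angle
  equivalence.\<close>

lemma equivalence_transports_angles:
  fixes C :: "('o, 'm) cat" and D :: "('p, 'q) cat"
  assumes "weak_pre_angulated_category C A n S T" "n \<ge> 1" "additive_category D A'"
    and "is_equivalence C D F"
  obtains G S' \<Phi> \<Psi> where "angle_pullback D C G A' A n S T S' \<Phi> \<Psi>"
    "angle_equivalence n C A S T D A' S' (angle_pullback.T' D C G n T S' \<Phi>) F"
proof -
  interpret C: weak_pre_angulated_category C A n S T by fact
  interpret D: additive_category D A' by fact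
  note CD = C.category_axioms D.category_axioms
  obtain G \<eta> \<kappa> where F: "is_functor C D F" and G: "is_functor D C G"
    and \<eta>: "natural_iso C C id_functor (comp_functor G F) \<eta>"
    and \<kappa>: "natural_iso D D id_functor (comp_functor F G) \<kappa>"
    using assms(4) is_equivalence_iff[OF CD] by blast
  obtain \<phi> where \<phi>: "natural_iso C C (comp_functor G F) id_functor \<phi>"
    "\<And>X. X \<in> Ob C \<Longrightarrow> \<phi> X \<cdot>\<^bsub>C\<^esub> \<eta> X = Idn C X"
    "\<And>X. X \<in> Ob C \<Longrightarrow> \<eta> X \<cdot>\<^bsub>C\<^esub> \<phi> X = Idn C (Fob G (Fob F X))"
    by (rule natural_iso_inverse[OF CD(1,1) functor_id[OF CD(1)] functor_comp[OF F G] \<eta>]) simp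
  have S: "is_functor C C S" using C.autoequivalence_S by (simp add: is_equivalence_def)
  have eqG: "is_equivalence D C G"
    using F G \<eta> \<kappa> is_equivalence_iff[OF CD(2,1)] by blast
  define S' where "S' = comp_functor F (comp_functor S G)"
  have eqS': "autoequivalence D S'"
    unfolding S'_def by (intro is_equivalence_comp[of _ C] CD assms(4) C.autoequivalence_S eqG)
  have S': "is_functor D D S'" using eqS' by (simp add: is_equivalence_def)
  have S'_simp: "Fob S' X = Fob F (Fob S (Fob G X))" "Fmor S' f = Fmor F (Fmor S (Fmor G f))" for X f
    by (simp_all add: S'_def)
  note [simp] = functor_arrow[OF F] functor_arrow[OF G] functor_arrow[OF S] S'_simp
    C.Src_Ob C.Tgt_Ob D.Src_Ob D.Tgt_Ob natural_iso_arrow(1-4)[OF \<eta>] natural_iso_arrow(1-4)[OF \<phi>(1)]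
  \<comment> \<open>\<open>G S' X\<close> is \<open>G F\<close> applied to \<open>S (G X)\<close>,
    so the unit and its inverse at \<open>S (G X)\<close> connect the two objects.\<close>
  define \<Phi> \<Psi> where "\<Phi> = (\<lambda>X. \<phi> (Fob S (Fob G X)))" and "\<Psi> = (\<lambda>X. \<eta> (Fob S (Fob G X)))"
  have \<Phi>: "natural_iso D C (comp_functor G S') (comp_functor S G) \<Phi>"
  proof (rule natural_isoI)
    fix f assume "f \<in> Mor D"
    then show "\<Phi> (Tgt D f) \<cdot>\<^bsub>C\<^esub> Fmor (comp_functor G S') f
        = Fmor (comp_functor S G) f \<cdot>\<^bsub>C\<^esub> \<Phi> (Src D f)"
      using natural_iso_arrow(5)[OF \<phi>(1), of "Fmor S (Fmor G f)"] by (simp add: \<Phi>_def)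
  qed (simp_all add: \<Phi>_def)
  have ff: "ff_ess_surj D C G" "ff_ess_surj C D F"
    using is_equivalence_imp_ff_ess_surj CD eqG assms(4) by blast+
  have pb: "angle_pullback D C G A' A n S T S' \<Phi> \<Psi>"
  proof (intro angle_pullback.intro ff_ess_surj_additive2.intro angle_pullback_axioms.intro
      ff assms(1-3) C.additive_category_axioms eqS' \<Phi>)
    fix X assume "X \<in> Ob D"
    then show "\<Psi> X \<in> Hom C (Fob S (Fob G X)) (Fob G (Fob S' X))"
      "\<Psi> X \<cdot>\<^bsub>C\<^esub> \<Phi> X = Idn C (Fob G (Fob S' X))" "\<Phi> X \<cdot>\<^bsub>C\<^esub> \<Psi> X = Idn C (Fob S (Fob G X))"
      using \<phi>(2,3)[of "Fob S (Fob G X)"] by (simp_all add: Hom_def \<Phi>_def \<Psi>_def)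
  qed
  interpret pb: angle_pullback D C G A' A n S T S' \<Phi> \<Psi> by (rule pb)
  interpret F: ff_ess_surj_additive2 C D F A A'
    by (intro ff_ess_surj_additive2.intro ff C.additive_category_axioms D.additive_category_axioms)
  \<comment> \<open>\<open>S' F X\<close> is \<open>F S\<close> applied to \<open>G F X\<close>, so
    \<open>F S\<close> of the unit at \<open>X\<close> has the required source and target.\<close>
  define \<Theta> where "\<Theta> = (\<lambda>X. Fmor F (Fmor S (\<eta> X)))"
  have \<Theta>: "natural_iso C D (comp_functor F S) (comp_functor S' F) \<Theta>"
  proof (rule natural_isoI)
    fix X assume "X \<in> Ob C"
    then show "isomorphism_in D (\<Theta> X)"
      unfolding \<Theta>_def by (intro functor_iso[OF CD F] functor_iso[OF CD(1,1) S]) simp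
  next
    fix f assume [simp]: "f \<in> Mor C"
    have "Fmor F (Fmor S (\<eta> (Tgt C f) \<cdot>\<^bsub>C\<^esub> f)) = Fmor F (Fmor S (Fmor G (Fmor F f) \<cdot>\<^bsub>C\<^esub> \<eta> (Src C f)))"
      using natural_iso_arrow(5)[OF \<eta>, of f] by simp
    then show "\<Theta> (Tgt C f) \<cdot>\<^bsub>D\<^esub> Fmor (comp_functor F S) f
        = Fmor (comp_functor S' F) f \<cdot>\<^bsub>D\<^esub> \<Theta> (Src C f)"
      by (simp add: \<Theta>_def)
  qed (simp_all add: \<Theta>_def)
  have "map_seq C D F \<Theta> X \<in> pb.T'" if XT: "X \<in> T" for X
  proof -
    note X = C.T_sigma_seq[OF XT]
    note Y = map_seq_arrow[OF CD F S S' \<Theta> X]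
    note Ynth = map_seq_nth[OF sigma_seqD(1)[OF X], where C = C and D = D and F = F and \<Theta> = \<Theta>]
    let ?Y = "map_seq C D F \<Theta> X"
    note [simp] = sigma_seqD[OF X] Y
    \<comment> \<open>The units at the objects of \<open>X\<close> form the isomorphism from
      \<open>X\<close> to \<open>K ?Y\<close>.\<close>
    define t where "t = map (\<lambda>i. \<eta> (Src C (X ! i))) [0..<Suc (Suc n)]"
    have t: "length t = Suc (Suc n)" "i \<le> Suc n \<Longrightarrow> t ! i = \<eta> (Src C (X ! i))" for i
      by (simp_all add: t_def del: upt_Suc)
    have nat: "\<eta> (Tgt C f) \<cdot>\<^bsub>C\<^esub> f = Fmor G (Fmor F f) \<cdot>\<^bsub>C\<^esub> \<eta> (Src C f)" if "f \<in> Mor C" for f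
      using natural_iso_arrow(5)[OF \<eta> that] by simp
    have "seq_mor C n S X (pb.K ?Y) t"
    proof (rule seq_morI)
      fix i assume "i \<le> n"
      then show "t ! Suc i \<cdot>\<^bsub>C\<^esub> X ! i = pb.K ?Y ! i \<cdot>\<^bsub>C\<^esub> t ! i"
        using nat[of "X ! i"] Ynth(2)[of i] by (simp add: t)
    next
      let ?x = "Src C (X ! 0)" and ?h = "Fmor S (\<eta> (Src C (X ! 0))) \<cdot>\<^bsub>C\<^esub> X ! Suc n"
      have h: "?h \<in> Mor C" "Src C ?h = Src C (X ! Suc n)" "Tgt C ?h = Fob S (Fob G (Fob F ?x))"
        by simp_all
      \<comment> \<open>The last morphism of \<open>?Y\<close> is \<open>F ?h\<close>. Naturality of
        the unit at \<open>?h\<close> produces the unit at \<open>S (G (F ?x))\<close>, which is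
        \<open>\<Psi> (Fob F ?x)\<close> and cancels against \<open>\<Phi>\<close>; this is where
        the choices of \<open>\<Theta>\<close> and \<open>\<Phi>\<close> fit together.\<close>
      have "pb.K ?Y ! Suc n \<cdot>\<^bsub>C\<^esub> t ! Suc n
          = \<Phi> (Fob F ?x) \<cdot>\<^bsub>C\<^esub> Fmor G (Fmor F ?h) \<cdot>\<^bsub>C\<^esub> \<eta> (Src C (X ! Suc n))"
        by (simp add: t Ynth(3) \<Theta>_def \<Phi>_def)
      also have "\<dots> = \<Phi> (Fob F ?x) \<cdot>\<^bsub>C\<^esub> \<Psi> (Fob F ?x) \<cdot>\<^bsub>C\<^esub> ?h"
        using nat[OF h(1)] h by (simp only: \<Psi>_def)
      also have "\<dots> = ?h" by (rule pb.\<Phi>_\<Psi>_cancel) simp_all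
      finally show "Fmor S (t ! 0) \<cdot>\<^bsub>C\<^esub> X ! Suc n = pb.K ?Y ! Suc n \<cdot>\<^bsub>C\<^esub> t ! Suc n"
        by (simp add: t)
    qed (simp_all add: t)
    then have "X \<in> T \<longleftrightarrow> pb.K ?Y \<in> T"
      by (rule C.T_iso[rotated 2]) (simp_all add: t X)
    then show ?thesis using XT Y(3) pb.T'_iff by blast
  qed
  then have "angulated_functor n C A S T D A' S' pb.T' F"
    unfolding angulated_functor_def using F.G_additive \<Theta> unfolding map_seq_def by blast
  then show ?thesis
    using that[OF pb] assms(4) by (simp add: angle_equivalence_def)
qed

text \<open>An addition is pulled back along a functor leaving \<open>D\<close>, hence along the
  quasi-inverse of \<open>F\<close>.\<close>

lemma equivalence_additive:
  assumes "additive_category C A" "category D" "is_equivalence C D F"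
  shows "\<exists>A'. additive_category D A'"
proof -
  interpret C: additive_category C A by fact
  interpret D: category D by fact
  note CD = C.category_axioms D.category_axioms
  obtain G where "is_equivalence D C G"
    using assms(3) is_equivalence_iff[OF CD] is_equivalence_iff[OF CD(2,1)] by blast
  then interpret ff_ess_surj_additive D C G A
    by (intro ff_ess_surj_additive.intro is_equivalence_imp_ff_ess_surj CD assms(1))
  show ?thesis using pullback_additive by blast
qed

text \<open>Additivity of \<open>C'\<close> is part of the conclusion. The rest is claimed for every
  additive structure on \<open>C'\<close>, which is possible because an equivalence respects any two
  such structures.\<close>

theorem theorem3p4:
  fixes n :: nat
    and C :: "('o, 'm) cat" and A :: "('o, 'm) hom_addition"
    and S :: "('o, 'm, 'o, 'm) cat_functor" and T :: "'m list set"
    and C' :: "('p, 'q) cat" and F :: "('o, 'm, 'p, 'q) cat_functor"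
  assumes "n \<ge> 1" and "category C'" and "is_equivalence C C' F"
  shows "(weak_pre_angulated_category C A n S T \<longrightarrow>
            (\<exists>A'. additive_category C' A') \<and>
            (\<forall>A'. additive_category C' A' \<longrightarrow>
               (\<exists>S' T'. weak_pre_angulated_category C' A' n S' T' \<and>
                        angle_equivalence n C A S T C' A' S' T' F))) \<and>
         (weak_angulated_category C A n S T \<longrightarrow>
            (\<exists>A'. additive_category C' A') \<and>
            (\<forall>A'. additive_category C' A' \<longrightarrow>
               (\<exists>S' T'. weak_angulated_category C' A' n S' T' \<and>
                        angle_equivalence n C A S T C' A' S' T' F)))"
proof -
  have add: "\<exists>A'. additive_category C' A'" if "weak_pre_angulated_category C A n S T"
    using equivalence_additive[OF weak_pre_angulated_category.axioms(1)[OF that] assms(2,3)] .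
  have pre: "weak_pre_angulated_category C A n S T" if "weak_angulated_category C A n S T"
    using that by (rule weak_angulated_category.axioms(1))
  \<comment> \<open>One choice of \<open>S'\<close> and \<open>T'\<close> serves both versions; (F4)
    is inherited whenever it holds in \<open>C\<close>.\<close>
  have "\<exists>S' T'. weak_pre_angulated_category C' A' n S' T' \<and>
      (weak_angulated_category C A n S T \<longrightarrow> weak_angulated_category C' A' n S' T') \<and>
      angle_equivalence n C A S T C' A' S' T' F"
    if wpa: "weak_pre_angulated_category C A n S T" "additive_category C' A'" for A'
  proof -
    obtain G S' \<Phi> \<Psi> where pb: "angle_pullback C' C G A' A n S T S' \<Phi> \<Psi>"
      and eq: "angle_equivalence n C A S T C' A' S' (angle_pullback.T' C' C G n T S' \<Phi>) F"
      using equivalence_transports_angles[OF wpa(1) assms(1) wpa(2) assms(3)] by blast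
    show ?thesis
      using angle_pullback.weak_pre_angulated[OF pb] angle_pullback.weak_angulated[OF pb] eq by blast
  qed
  then show ?thesis using add pre by blast
qed

end
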